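(* Let $\alpha>0$, $0<\beta<1/2$ and $f:\mathbb{Z}\to\mathbb{R}$. (i) If $f\in\Lambda_H^\alpha\cap\ell_{-\beta}$, then $(-\Delta_d)^{-\beta}f\in\Lambda_H^{\alpha+2\beta}$. (ii) If $f\in\ell^\infty(\mathbb{Z})\cap\ell_{-\beta}$, then $(-\Delta_d)^{-\beta}f\in\Lambda_H^{2\beta}$.
   Context: Heat semigroup: $I_n(t)=\sum_{m=0}^\infty\frac{1}{m!\,\Gamma(m+n+1)}(t/2)^{2m+n}$ for $n\in\mathbb{N}_0$, $I_{-n}=I_n$; $G(t,n)=e^{-2t}I_n(2t)$ for $t>0$, $n\in\mathbb{Z}$; $e^{t\Delta_d}f(n)=\sum_{j\in\mathbb{Z}}G(t,n-j)f(j)$, where $\Delta_df(n)=f(n+1)-2f(n)+f(n-1)$. For $\alpha>0$, $\Lambda_H^\alpha$ is the set of $f:\mathbb{Z}\to\mathbb{R}$ with $\frac{f}{1+|\cdot|^\alpha}\in\ell^\infty(\mathbb{Z})$ for which there is $C_\alpha>0$ with $\|\partial_t^ke^{t\Delta_d}f\|_\infty\le C_\alpha t^{-k+\alpha/2}$ for all $t>0$, where $k=[\alpha/2]+1$, $[\cdot]$ is the integer part and $\|\cdot\|_\infty$ is the supremum norm over $\mathbb{Z}$. For $0<\beta<1/2$, $\ell_{-\beta}=\{u:\mathbb{Z}\to\mathbb{R}:\ \sum_{m\in\mathbb{Z}}\frac{|u(m)|}{(1+|m|)^{1-2\beta}}<\infty\}$, and the negative fractional power is $(-\Delta_d)^{-\beta}f(n)=\frac{1}{\Gamma(\beta)}\int_0^\infty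 e^{\tau\Delta_d}f(n)\frac{d\tau}{\tau^{1-\beta}}$, $n\in\mathbb{Z}$. *)

theory Defs
  imports "HOL-Analysis.Analysis"
begin

definition besselI :: "int \<Rightarrow> real \<Rightarrow> real" where
  "besselI n t =
     (\<Sum>m. 1 / (fact m * Gamma (real m + real (nat \<bar>n\<bar>) + 1)) * (t / 2) ^ (2 * m + nat \<bar>n\<bar>))"

definition heat_kernel :: "real \<Rightarrow> int \<Rightarrow> real" where
  "heat_kernel t n = exp (- 2 * t) * besselI n (2 * t)"

text \<open>The heat semigroup of the discrete Laplacian; only used for \<open>t > 0\<close>. The series converges
  absolutely whenever \<open>f\<close> has at most polynomial growth, and then defines a smooth function
  of \<open>t > 0\<close>.\<close>

definition heat_semigroup :: "real \<Rightarrow> (int \<Rightarrow> real) \<Rightarrow> int \<Rightarrow> real" where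
  "heat_semigroup t f n = (\<Sum>\<^sub>\<infinity>j\<in>UNIV. heat_kernel t (n - j) * f j)"

text \<open>The bound on the supremum norm over the integers is written out pointwise, with the constant
  independent of \<open>n\<close> and \<open>t\<close>, because the real-valued \<^const>\<open>Sup\<close> is unspecified on unbounded
  sets. The growth condition ensures that all the time derivatives exist.\<close>

definition Lambda_H :: "real \<Rightarrow> (int \<Rightarrow> real) set" where
  "Lambda_H \<alpha> = {f. bounded (range (\<lambda>n. f n / (1 + real_of_int \<bar>n\<bar> powr \<alpha>))) \<and>
     (let k = nat \<lfloor>\<alpha> / 2\<rfloor> + 1 in
       \<exists>C>0. \<forall>t>0. \<forall>n.
         \<bar>(deriv ^^ k) (\<lambda>s. heat_semigroup s f n) t\<bar> \<le> C * t powr (- real k + \<alpha> / 2))}"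

definition ell_infty :: "(int \<Rightarrow> real) set" where
  "ell_infty = {f. bounded (range f)}"

definition ell_neg :: "real \<Rightarrow> (int \<Rightarrow> real) set" where
  "ell_neg \<beta> = {u. (\<lambda>m. \<bar>u m\<bar> / (1 + real_of_int \<bar>m\<bar>) powr (1 - 2 * \<beta>)) summable_on UNIV}"

text \<open>For \<open>0 < \<beta> < 1/2\<close> and \<open>f\<close> in \<open>ell_neg \<beta>\<close> the integral converges absolutely, since the
  integral of \<open>heat_kernel \<tau> m / \<tau> powr (1 - \<beta>)\<close> over \<open>\<tau> > 0\<close> is of order
  \<open>(1 + \<bar>m\<bar>) powr (2 * \<beta> - 1)\<close>.\<close>

definition neg_frac_power :: "real \<Rightarrow> (int \<Rightarrow> real) \<Rightarrow> int \<Rightarrow> real" where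
  "neg_frac_power \<beta> f n =
     1 / Gamma \<beta> * (LBINT \<tau>:{0<..}. heat_semigroup \<tau> f n / \<tau> powr (1 - \<beta>))"

end

theory Submission
  imports Defs
begin

text \<open>
  Write \<open>H\<^sub>t\<close> for the heat semigroup, \<open>p\<close> for its kernel, \<open>\<Delta>\<close> for the discrete Laplacian and
  \<open>g\<close> for \<open>(- \<Delta>)\<^sup>-\<^sup>\<beta> f\<close>. The heat flow of \<open>g\<close> is a superposition of later values of the heat flow
  of \<open>f\<close>: by Fubini and the semigroup law,
  \<open>H\<^sub>t g = 1 / \<Gamma>(\<beta>) \<integral> H\<^bsub>t+\<tau>\<^esub> f d\<tau> / \<tau> powr (1 - \<beta>)\<close>, and \<open>l\<close> time derivatives amount to replacing \<open>f\<close>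
  by \<open>\<Delta>\<^sup>l f\<close> on the right. If \<open>H\<^sub>s (\<Delta>\<^sup>l f)\<close> is bounded by a multiple of \<open>s powr (- l + \<alpha> / 2)\<close> with
  \<open>l > \<alpha> / 2 + \<beta>\<close>, then splitting the integral at \<open>\<tau> = t\<close> bounds it by a multiple of
  \<open>t powr (- l + \<alpha> / 2 + \<beta>)\<close>, which is the estimate demanded of \<open>g\<close>. The order \<open>l\<close> belonging to
  \<open>\<alpha> + 2 \<beta>\<close> is the order \<open>k\<close> belonging to \<open>\<alpha>\<close> or \<open>k + 1\<close>, and one more derivative is
  gained by the smoothing estimate \<open>\<bar>H\<^sub>t (\<Delta> u)\<bar> \<le> 8 sup \<bar>u\<bar> / t\<close>. For bounded \<open>f\<close> the same argument runs
  with \<open>\<alpha> = 0\<close> and \<open>l = 1\<close>, where the required decay is the smoothing estimate itself.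

  The semigroup is handled algebraically. On sequences of exponential growth, \<open>H\<^sub>t\<close> is
  \<open>exp (- 2 t)\<close> times the exponential series of the finite-range operator
  \<open>f \<mapsto> f(n - 1) + f(n + 1)\<close> (lemma \<open>heat_semigroup_series\<close>), so that the time derivative and the
  semigroup law are facts about a scalar power series in \<open>t\<close>, and \<open>\<Delta>\<close> commutes with \<open>H\<^sub>t\<close> because shifts do.
  Iterated time derivatives turn into iterated Laplacians, which are finite linear combinations of shifts
  and pass through the time integral by linearity.

  All analytic information on the kernel comes from two elementary facts. The kernel decreases in the
  distance to the origin (lemma \<open>heat_kernel_antimono\<close>, from the three-term Bessel recurrence),
  and \<open>p(t, 0) \<le> 1 / sqrt t\<close> (from the size of the central binomial coefficients). Monotonicity makes
  the total variation of \<open>p\<close> telescope to \<open>2 p(t, 0)\<close>; writing \<open>\<Delta>\<close> as a product of two first differences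
  and letting each half of the time absorb one of them gives the smoothing estimate. Monotonicity and the
  second moment \<open>2 t\<close> give \<open>p(t, m) \<le> 6 t / \<bar>m\<bar>\<^sup>3\<close>. Using this bound before the time
  \<open>\<tau> = m\<^sup>2\<close> and \<open>p(\<tau>, m) \<le> 1 / sqrt \<tau>\<close> after it, the kernel of \<open>(- \<Delta>)\<^sup>-\<^sup>\<beta>\<close> is at most of order \<open>(1 + \<bar>m\<bar>) powr (2 \<beta> - 1)\<close>
  (lemma \<open>riesz_kernel_bound\<close>). This justifies Fubini for \<open>f\<close> in \<open>ell_neg \<beta>\<close>, and it also yields
  the growth condition: up to constants, over the indices \<open>\<bar>j\<bar> \<le> 2 \<bar>n\<bar>\<close> the kernel sums to
  \<open>(1 + \<bar>n\<bar>) powr (2 \<beta>)\<close> and \<open>f\<close> is at most \<open>(1 + \<bar>n\<bar>) powr \<alpha>\<close>, and for the other indices the summability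
  condition on \<open>f\<close> takes over.
\<close>

section \<open>Sequences of exponential growth and the neighbour sum\<close>

text \<open>A class that contains all sequences of polynomial growth and is stable under shifts, differences
  and the heat flow itself, so that the calculus of the semigroup can be developed inside it.\<close>

definition exp_growth :: "(int \<Rightarrow> real) \<Rightarrow> bool" where
  "exp_growth f \<longleftrightarrow> (\<exists>C r. 0 \<le> r \<and> (\<forall>j. \<bar>f j\<bar> \<le> C * exp (r * \<bar>real_of_int j\<bar>)))"

definition neighbour_sum :: "(int \<Rightarrow> real) \<Rightarrow> int \<Rightarrow> real" where
  "neighbour_sum f n = f (n - 1) + f (n + 1)"

definition laplacian :: "(int \<Rightarrow> real) \<Rightarrow> int \<Rightarrow> real" where
  "laplacian f n = f (n + 1) - 2 * f n + f (n - 1)"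

definition forward_diff :: "(int \<Rightarrow> real) \<Rightarrow> int \<Rightarrow> real" where
  "forward_diff f n = f (n + 1) - f n"

lemma exp_growthE:
  assumes "exp_growth f"
  obtains C r where "0 \<le> C" "0 \<le> r" "\<And>j. \<bar>f j\<bar> \<le> C * exp (r * \<bar>real_of_int j\<bar>)"
proof -
  from assms obtain C r where Cr: "0 \<le> r" "\<And>j. \<bar>f j\<bar> \<le> C * exp (r * \<bar>real_of_int j\<bar>)"
    unfolding exp_growth_def by blast
  have "0 \<le> C" using Cr(2)[of 0] by simp
  with Cr that show thesis by blast
qed

lemma exp_growth_add:
  assumes "exp_growth f" "exp_growth g"
  shows "exp_growth (\<lambda>n. f n + g n)"
proof -
  obtain C r where f: "0 \<le> C" "0 \<le> r" "\<And>j. \<bar>f j\<bar> \<le> C * exp (r * \<bar>real_of_int j\<bar>)"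
    using assms(1) by (rule exp_growthE) blast
  obtain D s where g: "0 \<le> D" "0 \<le> s" "\<And>j. \<bar>g j\<bar> \<le> D * exp (s * \<bar>real_of_int j\<bar>)"
    using assms(2) by (rule exp_growthE) blast
  have "\<bar>f j + g j\<bar> \<le> (C + D) * exp (max r s * \<bar>real_of_int j\<bar>)" for j
  proof -
    have "C * exp (r * \<bar>real_of_int j\<bar>) \<le> C * exp (max r s * \<bar>real_of_int j\<bar>)"
      "D * exp (s * \<bar>real_of_int j\<bar>) \<le> D * exp (max r s * \<bar>real_of_int j\<bar>)"
      using f(1) g(1) by (auto intro!: mult_left_mono mult_right_mono)
    then show ?thesis using f(3)[of j] g(3)[of j] unfolding distrib_right by linarith
  qed
  moreover have "0 \<le> max r s" using f(2) by simp
  ultimately show ?thesis unfolding exp_growth_def by blast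
qed

lemma exp_growth_cmult:
  assumes "exp_growth f"
  shows "exp_growth (\<lambda>n. c * f n)"
proof -
  obtain C r where f: "0 \<le> C" "0 \<le> r" "\<And>j. \<bar>f j\<bar> \<le> C * exp (r * \<bar>real_of_int j\<bar>)"
    using assms(1) by (rule exp_growthE) blast
  have "\<bar>c * f j\<bar> \<le> (\<bar>c\<bar> * C) * exp (r * \<bar>real_of_int j\<bar>)" for j
    using mult_left_mono[OF f(3)[of j], of "\<bar>c\<bar>"] by (simp add: abs_mult mult.assoc)
  with f(2) show ?thesis unfolding exp_growth_def by blast
qed

lemma exp_growth_shift:
  assumes "exp_growth f"
  shows "exp_growth (\<lambda>n. f (n + i))"
proof -
  obtain C r where f: "0 \<le> C" "0 \<le> r" "\<And>j. \<bar>f j\<bar> \<le> C * exp (r * \<bar>real_of_int j\<bar>)"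
    using assms(1) by (rule exp_growthE) blast
  have "\<bar>f (j + i)\<bar> \<le> (C * exp (r * \<bar>real_of_int i\<bar>)) * exp (r * \<bar>real_of_int j\<bar>)" for j
  proof -
    have "r * \<bar>real_of_int (j + i)\<bar> \<le> r * (\<bar>real_of_int i\<bar> + \<bar>real_of_int j\<bar>)"
      using f(2) by (intro mult_left_mono) auto
    then have "C * exp (r * \<bar>real_of_int (j + i)\<bar>)
        \<le> C * exp (r * (\<bar>real_of_int i\<bar> + \<bar>real_of_int j\<bar>))"
      using f(1) by (intro mult_left_mono) auto
    with f(3)[of "j + i"] show ?thesis by (simp add: exp_add algebra_simps)
  qed
  with f(2) show ?thesis unfolding exp_growth_def by blast
qed

lemma exp_growth_diff:
  assumes "exp_growth f" "exp_growth g"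
  shows "exp_growth (\<lambda>n. f n - g n)"
  using exp_growth_add[OF assms(1) exp_growth_cmult[OF assms(2), of "-1"]] by simp

lemma exp_growth_neighbour_sum: "exp_growth f \<Longrightarrow> exp_growth (neighbour_sum f)"
  using exp_growth_add[OF exp_growth_shift[of f "-1"] exp_growth_shift[of f 1]]
  by (simp add: neighbour_sum_def[abs_def])

lemma laplacian_eq: "laplacian f = (\<lambda>n. neighbour_sum f n - 2 * f n)"
  by (auto simp: laplacian_def neighbour_sum_def)

lemma exp_growth_laplacian: "exp_growth f \<Longrightarrow> exp_growth (laplacian f)"
  unfolding laplacian_eq by (intro exp_growth_diff exp_growth_cmult exp_growth_neighbour_sum)

lemma exp_growth_forward_diff: "exp_growth f \<Longrightarrow> exp_growth (forward_diff f)"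
  using exp_growth_diff[OF exp_growth_shift[of f 1]] by (simp add: forward_diff_def[abs_def])

lemma exp_growth_funpow:
  assumes "\<And>f. exp_growth f \<Longrightarrow> exp_growth (D f)" "exp_growth f"
  shows "exp_growth ((D ^^ k) f)"
  using assms(2) by (induction k) (auto intro: assms(1))

lemma exp_growth_bounded:
  assumes "\<And>j. \<bar>f j\<bar> \<le> B"
  shows "exp_growth f"
  unfolding exp_growth_def by (rule exI[of _ B], rule exI[of _ 0]) (use assms in auto)

text \<open>The neighbour sum loses only a constant factor on an exponential weight. Its powers therefore grow
  geometrically, which makes every exponential series below entire in \<open>t\<close>.\<close>

lemma neighbour_sum_power_bound:
  assumes "0 \<le> r" and "\<And>j. \<bar>f j\<bar> \<le> C * exp (r * \<bar>real_of_int j\<bar>)"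
  shows "\<bar>(neighbour_sum ^^ N) f n\<bar> \<le> C * exp (r * \<bar>real_of_int n\<bar>) * (2 * exp r) ^ N"
proof (induction N arbitrary: n)
  case 0
  then show ?case using assms(2) by simp
next
  case (Suc N)
  have C: "0 \<le> C" using assms(2)[of 0] by simp
  have *: "exp (r * \<bar>real_of_int i\<bar>) \<le> exp r * exp (r * \<bar>real_of_int n\<bar>)"
    if "i = n - 1 \<or> i = n + 1" for i
  proof -
    have "r * \<bar>real_of_int i\<bar> \<le> r * (1 + \<bar>real_of_int n\<bar>)"
      using that assms(1) by (intro mult_left_mono) auto
    then show ?thesis by (simp flip: exp_add add: algebra_simps)
  qed
  have "\<bar>(neighbour_sum ^^ N) f i\<bar> \<le> C * (exp r * exp (r * \<bar>real_of_int n\<bar>)) * (2 * exp r) ^ N"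
    if "i = n - 1 \<or> i = n + 1" for i
    using Suc.IH[of i] mult_right_mono[OF mult_left_mono[OF *[OF that] C], of "(2 * exp r) ^ N"]
    by simp
  from this[of "n - 1"] this[of "n + 1"] show ?case
    by (simp add: neighbour_sum_def[of "(neighbour_sum ^^ N) f"] algebra_simps)
qed

lemma sum_choose_Suc:
  fixes g :: "nat \<Rightarrow> real"
  shows "(\<Sum>a\<le>Suc N. real (Suc N choose a) * g a)
    = (\<Sum>a\<le>N. real (N choose a) * g a) + (\<Sum>a\<le>N. real (N choose a) * g (Suc a))"
proof -
  have "(\<Sum>a\<le>Suc N. real (Suc N choose a) * g a)
      = g 0 + (\<Sum>a\<le>N. real (N choose Suc a) * g (Suc a)) + (\<Sum>a\<le>N. real (N choose a) * g (Suc a))"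
    by (subst sum.atMost_Suc_shift) (simp add: algebra_simps sum.distrib)
  also have "g 0 + (\<Sum>a\<le>N. real (N choose Suc a) * g (Suc a)) = (\<Sum>a\<le>Suc N. real (N choose a) * g a)"
    by (subst sum.atMost_Suc_shift) simp
  also have "\<dots> = (\<Sum>a\<le>N. real (N choose a) * g a)" by simp
  finally show ?thesis .
qed

text \<open>The binomial theorem for the sum of the two commuting shifts.\<close>

lemma neighbour_sum_power:
  "(neighbour_sum ^^ N) f n = (\<Sum>a\<le>N. real (N choose a) * f (n - int a + int (N - a)))"
proof (induction N arbitrary: n)
  case 0
  then show ?case by simp
next
  case (Suc N)
  have "(neighbour_sum ^^ Suc N) f n
      = (\<Sum>a\<le>N. real (N choose a) * f (n + 1 - int a + int (N - a)))
        + (\<Sum>a\<le>N. real (N choose a) * f (n - 1 - int a + int (N - a)))"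
    by (simp add: neighbour_sum_def Suc.IH)
  also have "\<dots> = (\<Sum>a\<le>N. real (N choose a) * f (n - int a + int (Suc N - a)))
        + (\<Sum>a\<le>N. real (N choose a) * f (n - int (Suc a) + int (Suc N - Suc a)))"
    by (intro arg_cong2[where f = "(+)"] sum.cong) (auto simp: algebra_simps Suc_diff_le)
  also have "\<dots> = (\<Sum>a\<le>Suc N. real (Suc N choose a) * f (n - int a + int (Suc N - a)))"
    by (rule sum_choose_Suc[symmetric])
  finally show ?case .
qed

section \<open>Exponential series\<close>

text \<open>Domination by the product of two exponential series: the one absolute convergence criterion behind
  all rearrangements of double series.\<close>

lemma summable_exp_product:
  fixes \<phi> :: "nat \<Rightarrow> nat \<Rightarrow> real"
  assumes "\<And>a b. \<bar>\<phi> a b\<bar> \<le> C * (x ^ a / fact a) * (y ^ b / fact b)" "0 \<le> C" "0 \<le> x" "0 \<le> y"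
  shows "(\<lambda>(a, b). \<phi> a b) summable_on UNIV"
proof -
  have s: "(\<lambda>a. z ^ a / fact a) summable_on UNIV" if "0 \<le> z" for z :: real
    using summable_exp[of z] that
    by (intro norm_summable_imp_summable_on) (simp add: divide_inverse mult.commute)
  have "(\<lambda>(a, b). C * (x ^ a / fact a) * (y ^ b / fact b)) summable_on (UNIV \<times> UNIV)"
  proof (rule summable_on_SigmaI)
    show "((\<lambda>b. (case (a, b) of (a, b) \<Rightarrow> C * (x ^ a / fact a) * (y ^ b / fact b)))
        has_sum C * (x ^ a / fact a) * (\<Sum>\<^sub>\<infinity>b. y ^ b / fact b)) UNIV" for a
      unfolding prod.case by (intro has_sum_cmult_right has_sum_infsum s assms)
    show "(\<lambda>a. C * (x ^ a / fact a) * (\<Sum>\<^sub>\<infinity>b. y ^ b / fact b)) summable_on UNIV"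
      by (intro summable_on_cmult_left summable_on_cmult_right s assms)
    show "0 \<le> (case (a, b) of (a, b) \<Rightarrow> C * (x ^ a / fact a) * (y ^ b / fact b))" for a b
      using assms by simp
  qed
  then have "(\<lambda>p. C * (x ^ fst p / fact (fst p)) * (y ^ snd p / fact (snd p))) summable_on UNIV"
    by (simp add: case_prod_unfold)
  then have "(\<lambda>p. norm (case p of (a, b) \<Rightarrow> \<phi> a b)) summable_on UNIV"
    by (rule Infinite_Sum.abs_summable_on_comparison_test') (use assms(1) in \<open>auto simp: case_prod_unfold\<close>)
  then show ?thesis by (rule abs_summable_summable)
qed

lemma has_sum_antidiagonal:
  fixes \<phi> :: "nat \<Rightarrow> nat \<Rightarrow> real"
  assumes "((\<lambda>(a, b). \<phi> a b) has_sum S) UNIV"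
  shows "(\<lambda>N. \<Sum>a\<le>N. \<phi> a (N - a)) sums S"
proof -
  have "((\<lambda>(N, a). \<phi> a (N - a)) has_sum S) (Sigma UNIV (\<lambda>N. {..N}))"
    using assms
    by (subst has_sum_reindex_bij_witness[where i = "\<lambda>(a, b). (a + b, a)" and j = "\<lambda>(N, a). (a, N - a)"
          and T = UNIV and h = "\<lambda>(a, b). \<phi> a b" and s' = S]) auto
  then have "((\<lambda>N. \<Sum>a\<le>N. \<phi> a (N - a)) has_sum S) UNIV"
    by (rule has_sum_SigmaD) (simp add: has_sum_finite)
  then show ?thesis by (rule has_sum_imp_sums)
qed

text \<open>The exponential generating function of \<open>c\<close>; for \<open>c N = (A ^^ N) f n\<close> it is the value at \<open>n\<close> of
  \<open>exp (t A) f\<close>.\<close>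

definition exp_series :: "real \<Rightarrow> (nat \<Rightarrow> real) \<Rightarrow> real" where
  "exp_series t c = (\<Sum>N. c N * t ^ N / fact N)"

lemma exp_series_summable:
  assumes "\<And>N. \<bar>c N\<bar> \<le> C * K ^ N"
  shows "summable (\<lambda>N. c N * t ^ N / fact N :: real)"
proof (rule summable_comparison_test')
  have "summable (\<lambda>N. C * ((\<bar>K\<bar> * \<bar>t\<bar>) ^ N / fact N))"
    using summable_exp[of "\<bar>K\<bar> * \<bar>t\<bar>"] by (intro summable_mult) (simp add: divide_inverse mult.commute)
  then show "summable (\<lambda>N. C * ((\<bar>K\<bar> * \<bar>t\<bar>) ^ N / fact N))" .
  have C: "0 \<le> C" using assms[of 0] by simp
  show "norm (c N * t ^ N / fact N) \<le> C * ((\<bar>K\<bar> * \<bar>t\<bar>) ^ N / fact N)" for N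
  proof -
    have "\<bar>c N\<bar> \<le> C * \<bar>K\<bar> ^ N"
      using assms[of N] mult_left_mono[OF abs_ge_self[of "K ^ N"] C] by (simp add: power_abs)
    then have "\<bar>c N\<bar> * \<bar>t\<bar> ^ N / fact N \<le> C * \<bar>K\<bar> ^ N * \<bar>t\<bar> ^ N / fact N"
      by (intro divide_right_mono mult_right_mono) auto
    then show ?thesis by (simp add: abs_mult power_abs power_mult_distrib algebra_simps)
  qed
qed

lemma exp_series_deriv:
  assumes "\<And>N. \<bar>c N\<bar> \<le> C * K ^ N"
  shows "((\<lambda>t. exp_series t c) has_real_derivative exp_series t (\<lambda>N. c (Suc N))) (at t)"
proof -
  have "((\<lambda>t. \<Sum>N. (c N / fact N) * t ^ N) has_real_derivative (\<Sum>N. diffs (\<lambda>N. c N / fact N) N * t ^ N)) (at t)"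
    using exp_series_summable[OF assms] by (intro termdiffs_strong_converges_everywhere) simp
  moreover have "diffs (\<lambda>N. c N / fact N) = (\<lambda>N. c (Suc N) / fact N)"
    by (rule ext) (simp add: diffs_def field_simps del: of_nat_Suc)
  ultimately show ?thesis by (simp add: exp_series_def[abs_def])
qed

text \<open>The functional equation of the exponential, for a sequence \<open>c\<close> in place of the powers of a number:
  expanding \<open>(s + t) ^ N\<close> binomially and summing over \<open>N = M + L\<close> in rows. The semigroup law is a special case.\<close>

lemma exp_series_shift:
  assumes "\<And>N. \<bar>c N\<bar> \<le> C * K ^ N"
  shows "(\<lambda>M. exp_series t (\<lambda>L. c (M + L)) * s ^ M / fact M) sums exp_series (s + t) c"
proof -
  define \<phi> where "\<phi> a b = c (a + b) * (s ^ a / fact a) * (t ^ b / fact b)" for a b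
  have C: "0 \<le> C" using assms[of 0] by simp
  have cb: "\<bar>c N\<bar> \<le> C * \<bar>K\<bar> ^ N" for N
    using assms[of N] mult_left_mono[OF abs_ge_self[of "K ^ N"] C] by (simp add: power_abs)
  have "\<bar>\<phi> a b\<bar> \<le> C * ((\<bar>K\<bar> * \<bar>s\<bar>) ^ a / fact a) * ((\<bar>K\<bar> * \<bar>t\<bar>) ^ b / fact b)" for a b
  proof -
    have "\<bar>c (a + b)\<bar> * (\<bar>s\<bar> ^ a / fact a * (\<bar>t\<bar> ^ b / fact b))
        \<le> C * \<bar>K\<bar> ^ (a + b) * (\<bar>s\<bar> ^ a / fact a * (\<bar>t\<bar> ^ b / fact b))"
      by (intro mult_right_mono cb) auto
    then show ?thesis
      by (simp add: \<phi>_def abs_mult power_abs power_add power_mult_distrib mult_ac)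
  qed
  then have sm: "(\<lambda>(a, b). \<phi> a b) summable_on UNIV"
    by (rule summable_exp_product) (use C in auto)
  then obtain S where S: "((\<lambda>(a, b). \<phi> a b) has_sum S) UNIV" by (auto simp: summable_on_def)
  have "(\<lambda>N. \<Sum>a\<le>N. \<phi> a (N - a)) sums S" by (rule has_sum_antidiagonal[OF S])
  moreover have "(\<Sum>a\<le>N. \<phi> a (N - a)) = c N * (s + t) ^ N / fact N" for N
  proof -
    have "(\<Sum>a\<le>N. \<phi> a (N - a)) = (\<Sum>a\<le>N. c N / fact N * (of_nat (N choose a) * s ^ a * t ^ (N - a)))"
      by (rule sum.cong) (auto simp: \<phi>_def binomial_fact)
    also have "\<dots> = c N / fact N * (s + t) ^ N"
      by (simp only: binomial_ring sum_distrib_left)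
    finally show ?thesis by simp
  qed
  ultimately have 1: "S = exp_series (s + t) c" by (simp add: exp_series_def sums_iff)
  have inner: "((\<lambda>b. \<phi> a b) has_sum (exp_series t (\<lambda>L. c (a + L)) * s ^ a / fact a)) UNIV" for a
  proof -
    have "(\<lambda>b. \<phi> a b) summable_on UNIV"
      using summable_on_SigmaD1[of \<phi> UNIV "\<lambda>_. UNIV" a] sm by simp
    then have "(\<lambda>b. \<phi> a b) sums infsum (\<phi> a) UNIV" and h: "((\<phi> a) has_sum infsum (\<phi> a) UNIV) UNIV"
      by (auto intro: has_sum_imp_sums has_sum_infsum)
    moreover have "(\<lambda>b. \<phi> a b) sums (exp_series t (\<lambda>L. c (a + L)) * (s ^ a / fact a))"
    proof -
      have "(\<lambda>L. c (a + L) * t ^ L / fact L) sums exp_series t (\<lambda>L. c (a + L))"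
        unfolding exp_series_def
      proof (intro summable_sums exp_series_summable)
        show "\<bar>c (a + L)\<bar> \<le> (C * \<bar>K\<bar> ^ a) * \<bar>K\<bar> ^ L" for L
          using cb[of "a + L"] by (simp add: power_add mult_ac)
      qed
      from sums_mult2[OF this, of "s ^ a / fact a"] show ?thesis
        by (simp add: \<phi>_def mult_ac)
    qed
    ultimately have "infsum (\<phi> a) UNIV = exp_series t (\<lambda>L. c (a + L)) * (s ^ a / fact a)"
      by (blast intro: sums_unique2)
    with h show ?thesis by simp
  qed
  have "((\<lambda>a. exp_series t (\<lambda>L. c (a + L)) * s ^ a / fact a) has_sum S) UNIV"
    by (rule has_sum_SigmaD[where f = "\<lambda>(a, b). \<phi> a b" and B = "\<lambda>_. UNIV"]) (use S inner in auto)
  then show ?thesis unfolding 1 by (rule has_sum_imp_sums)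
qed

section \<open>The heat semigroup as an exponential series\<close>

text \<open>The summand is a product of two Poisson weights with parameter \<open>t\<close>, taken at numbers whose
  difference is \<open>m\<close>. Thus \<open>heat_kernel t\<close> is the law of the difference of two independent Poisson variables.
  Splitting \<open>\<bar>m\<bar>\<close> into \<open>nat m\<close> and \<open>nat (- m)\<close> treats both signs of \<open>m\<close> uniformly.\<close>

lemma heat_kernel_poisson_product:
  "heat_kernel t m = exp (- 2 * t) * (\<Sum>k. t ^ (k + nat m) / fact (k + nat m) * (t ^ (k + nat (- m)) / fact (k + nat (- m))))"
proof -
  have "1 / (fact k * Gamma (real k + real (nat \<bar>m\<bar>) + 1)) * (2 * t / 2) ^ (2 * k + nat \<bar>m\<bar>)
      = t ^ (k + nat m) / fact (k + nat m) * (t ^ (k + nat (- m)) / fact (k + nat (- m)))" for k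
  proof -
    have "Gamma (real k + real (nat \<bar>m\<bar>) + 1) = fact (k + nat \<bar>m\<bar>)"
      using Gamma_fact[of "k + nat \<bar>m\<bar>", where 'a = real] by (simp add: add_ac)
    moreover have "t ^ (2 * k + nat \<bar>m\<bar>) = t ^ (k + nat m) * t ^ (k + nat (- m))"
      unfolding power_add[symmetric] by (rule arg_cong[where f = "power t"]) auto
    moreover have "(fact k * fact (k + nat \<bar>m\<bar>) :: real) = fact (k + nat m) * fact (k + nat (- m))"
      by (cases "m \<ge> 0") auto
    ultimately show ?thesis by simp
  qed
  then show ?thesis unfolding heat_kernel_def besselI_def by simp
qed

text \<open>Both sides are summations of the same absolutely convergent family over pairs \<open>(a, b)\<close> of step
  numbers to the left and to the right. Grouping by the endpoint \<open>j = n - a + b\<close> gives the heat kernel;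
  grouping by the total number \<open>N = a + b\<close> of steps gives the powers of the neighbour sum.\<close>

lemma heat_semigroup_series_has_sum:
  assumes "exp_growth f"
  shows "((\<lambda>j. heat_kernel t (n - j) * f j) has_sum
    (exp (- 2 * t) * exp_series t (\<lambda>N. (neighbour_sum ^^ N) f n))) UNIV"
proof -
  obtain C r where f: "0 \<le> C" "0 \<le> r" "\<And>j. \<bar>f j\<bar> \<le> C * exp (r * \<bar>real_of_int j\<bar>)"
    using assms(1) by (rule exp_growthE) blast
  define \<phi> where "\<phi> a b = (t ^ a / fact a) * (t ^ b / fact b) * f (n - int a + int b)" for a b
  have "\<bar>\<phi> a b\<bar> \<le> (C * exp (r * \<bar>real_of_int n\<bar>)) * ((\<bar>t\<bar> * exp r) ^ a / fact a) * ((\<bar>t\<bar> * exp r) ^ b / fact b)" for a b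
  proof -
    have "r * \<bar>real_of_int (n - int a + int b)\<bar> \<le> r * (\<bar>real_of_int n\<bar> + real a + real b)"
      using f(2) by (intro mult_left_mono) auto
    then have "C * exp (r * \<bar>real_of_int (n - int a + int b)\<bar>)
        \<le> C * exp (r * (\<bar>real_of_int n\<bar> + real a + real b))"
      using f(1) by (intro mult_left_mono) auto
    also have "\<dots> = C * exp (r * \<bar>real_of_int n\<bar>) * exp r ^ a * exp r ^ b"
      by (simp add: exp_add distrib_left exp_of_nat2_mult)
    finally have "\<bar>f (n - int a + int b)\<bar> \<le> C * exp (r * \<bar>real_of_int n\<bar>) * exp r ^ a * exp r ^ b"
      using f(3)[of "n - int a + int b"] by linarith
    then have "\<bar>f (n - int a + int b)\<bar> * (\<bar>t\<bar> ^ a / fact a * (\<bar>t\<bar> ^ b / fact b))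
      \<le> (C * exp (r * \<bar>real_of_int n\<bar>) * exp r ^ a * exp r ^ b) * (\<bar>t\<bar> ^ a / fact a * (\<bar>t\<bar> ^ b / fact b))"
      by (intro mult_right_mono) auto
    then show ?thesis
      by (simp add: \<phi>_def abs_mult power_abs power_mult_distrib mult_ac)
  qed
  then have sm: "(\<lambda>(a, b). \<phi> a b) summable_on UNIV"
    by (rule summable_exp_product) (use f in auto)
  then obtain S where S: "((\<lambda>(a, b). \<phi> a b) has_sum S) UNIV" by (auto simp: summable_on_def)
  have "(\<lambda>N. \<Sum>a\<le>N. \<phi> a (N - a)) sums S" by (rule has_sum_antidiagonal[OF S])
  moreover have "(\<Sum>a\<le>N. \<phi> a (N - a)) = (neighbour_sum ^^ N) f n * t ^ N / fact N" for N
  proof -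
    have "(\<Sum>a\<le>N. \<phi> a (N - a))
        = (\<Sum>a\<le>N. t ^ N / fact N * (real (N choose a) * f (n - int a + int (N - a))))"
      by (rule sum.cong) (auto simp: \<phi>_def binomial_fact power_add[symmetric] field_simps)
    also have "\<dots> = t ^ N / fact N * (neighbour_sum ^^ N) f n"
      by (simp only: neighbour_sum_power sum_distrib_left)
    finally show ?thesis by simp
  qed
  ultimately have 1: "S = exp_series t (\<lambda>N. (neighbour_sum ^^ N) f n)"
    by (simp add: exp_series_def sums_iff)
  \<comment> \<open>\<open>k\<close> is the smaller of the two step numbers, so \<open>(j, k)\<close> determines \<open>(a, b)\<close>.\<close>
  define \<psi> where "\<psi> j k = \<phi> (k + nat (n - j)) (k + nat (- (n - j)))" for j k
  have S2: "((\<lambda>(j, k). \<psi> j k) has_sum S) (UNIV \<times> UNIV)"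
    using S unfolding \<psi>_def
    by (subst has_sum_reindex_bij_witness[where i = "\<lambda>(a, b). (n - int a + int b, min a b)"
          and j = "\<lambda>(j, k). (k + nat (n - j), k + nat (- (n - j)))"
          and T = UNIV and h = "\<lambda>(a, b). \<phi> a b" and s' = S]) auto
  have inner: "((\<lambda>k. \<psi> j k) has_sum (exp (2 * t) * (heat_kernel t (n - j) * f j))) UNIV" for j
  proof -
    have "(\<lambda>k. \<psi> j k) summable_on UNIV"
      using summable_on_SigmaD1[of \<psi> UNIV "\<lambda>_. UNIV" j] S2 has_sum_imp_summable by blast
    then have "(\<lambda>k. \<psi> j k) sums infsum (\<psi> j) UNIV" and h: "((\<psi> j) has_sum infsum (\<psi> j) UNIV) UNIV"
      by (auto intro: has_sum_imp_sums has_sum_infsum)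
    moreover have p: "\<psi> j k = t ^ (k + nat (n - j)) / fact (k + nat (n - j)) *
        (t ^ (k + nat (- (n - j))) / fact (k + nat (- (n - j)))) * f j" for k
    proof -
      have "n - int (k + nat (n - j)) + int (k + nat (- (n - j))) = j" by auto
      then show ?thesis unfolding \<psi>_def \<phi>_def by metis
    qed
    ultimately have "infsum (\<psi> j) UNIV = (\<Sum>k. \<psi> j k)" by (simp add: sums_iff)
    also have "\<dots> = exp (2 * t) * (heat_kernel t (n - j) * f j)"
    proof (cases "f j = 0")
      case False
      from \<open>(\<lambda>k. \<psi> j k) sums _\<close> have "summable (\<lambda>k. \<psi> j k / f j)"
        by (intro summable_divide) (rule sums_summable)
      with False have "summable (\<lambda>k. t ^ (k + nat (n - j)) / fact (k + nat (n - j)) *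
        (t ^ (k + nat (- (n - j))) / fact (k + nat (- (n - j)))))"
        unfolding p by simp
      then show ?thesis unfolding p heat_kernel_poisson_product
        by (subst suminf_mult2[symmetric]) (auto simp: exp_minus field_simps)
    qed (simp add: p)
    finally show ?thesis using h by simp
  qed
  have "((\<lambda>j. exp (2 * t) * (heat_kernel t (n - j) * f j)) has_sum S) UNIV"
    by (rule has_sum_SigmaD[OF S2]) (use inner in auto)
  then have "((\<lambda>j. exp (- 2 * t) * (exp (2 * t) * (heat_kernel t (n - j) * f j))) has_sum exp (- 2 * t) * S) UNIV"
    by (rule has_sum_cmult_right)
  then show ?thesis using 1 by (simp add: exp_minus field_simps)
qed

lemma heat_semigroup_series:
  assumes "exp_growth f"
  shows "heat_semigroup t f n = exp (- 2 * t) * exp_series t (\<lambda>N. (neighbour_sum ^^ N) f n)"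
  unfolding heat_semigroup_def by (rule infsumI[OF heat_semigroup_series_has_sum[OF assms]])

lemma heat_semigroup_has_sum:
  assumes "exp_growth f"
  shows "((\<lambda>j. heat_kernel t (n - j) * f j) has_sum heat_semigroup t f n) UNIV"
  using heat_semigroup_series_has_sum[OF assms] heat_semigroup_series[OF assms] by simp

lemma heat_semigroup_add:
  assumes "exp_growth f" "exp_growth g"
  shows "heat_semigroup t (\<lambda>j. f j + g j) n = heat_semigroup t f n + heat_semigroup t g n"
  using has_sum_add[OF heat_semigroup_has_sum[OF assms(1)] heat_semigroup_has_sum[OF assms(2)], of t n t n]
  unfolding heat_semigroup_def by (intro infsumI) (simp add: distrib_left)

lemma heat_semigroup_cmult:
  "heat_semigroup t (\<lambda>j. c * f j) n = c * heat_semigroup t f n"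
  unfolding heat_semigroup_def by (subst infsum_cmult_right'[symmetric]) (simp add: mult_ac)

lemma heat_semigroup_diff:
  assumes "exp_growth f" "exp_growth g"
  shows "heat_semigroup t (\<lambda>j. f j - g j) n = heat_semigroup t f n - heat_semigroup t g n"
  using heat_semigroup_add[OF assms(1) exp_growth_cmult[OF assms(2), of "-1"], of t n]
    heat_semigroup_cmult[of t "-1" g n] by simp

lemma heat_semigroup_shift:
  "heat_semigroup t (\<lambda>j. f (j + i)) n = heat_semigroup t f (n + i)"
  unfolding heat_semigroup_def
  by (rule infsum_reindex_bij_witness[where j = "\<lambda>j. j + i" and i = "\<lambda>j. j - i"]) auto

lemma heat_semigroup_neighbour_sum:
  assumes "exp_growth f"
  shows "heat_semigroup t (neighbour_sum f) = neighbour_sum (heat_semigroup t f)"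
  using heat_semigroup_add[OF exp_growth_shift[OF assms, of "-1"] exp_growth_shift[OF assms, of 1]]
    heat_semigroup_shift[of t f "-1"] heat_semigroup_shift[of t f 1]
  by (simp add: neighbour_sum_def[abs_def] fun_eq_iff)

lemma heat_semigroup_laplacian:
  assumes "exp_growth f"
  shows "heat_semigroup t (laplacian f) = laplacian (heat_semigroup t f)"
  unfolding laplacian_eq
  using heat_semigroup_diff[OF exp_growth_neighbour_sum[OF assms] exp_growth_cmult[OF assms, of 2]]
  by (auto simp: heat_semigroup_neighbour_sum[OF assms] heat_semigroup_cmult)

lemma heat_semigroup_forward_diff:
  assumes "exp_growth f"
  shows "heat_semigroup t (forward_diff f) = forward_diff (heat_semigroup t f)"
  using heat_semigroup_diff[OF exp_growth_shift[OF assms, of 1] assms] heat_semigroup_shift[of t f 1]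
  by (simp add: forward_diff_def[abs_def] fun_eq_iff)

lemma heat_semigroup_funpow:
  assumes "\<And>f. exp_growth f \<Longrightarrow> exp_growth (D f)"
    and "\<And>f. exp_growth f \<Longrightarrow> heat_semigroup t (D f) = D (heat_semigroup t f)"
    and "exp_growth f"
  shows "heat_semigroup t ((D ^^ k) f) = (D ^^ k) (heat_semigroup t f)"
  by (induction k) (use assms exp_growth_funpow in auto)

lemma exp_growth_heat_semigroup:
  assumes "exp_growth f"
  shows "exp_growth (heat_semigroup t f)"
proof -
  obtain C r where f: "0 \<le> C" "0 \<le> r" "\<And>j. \<bar>f j\<bar> \<le> C * exp (r * \<bar>real_of_int j\<bar>)"
    using assms(1) by (rule exp_growthE) blast
  define s where "s = (\<Sum>N. 1 * (2 * exp r) ^ N * \<bar>t\<bar> ^ N / fact N)"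
  have sum: "summable (\<lambda>N. (2 * exp r) ^ N * \<bar>t\<bar> ^ N / fact N)"
    by (rule exp_series_summable[where C = 1 and K = "2 * exp r"]) simp
  have "\<bar>heat_semigroup t f n\<bar> \<le> (exp (- 2 * t) * C * s) * exp (r * \<bar>real_of_int n\<bar>)" for n
  proof -
    have le: "norm ((neighbour_sum ^^ N) f n * t ^ N / fact N)
        \<le> (C * exp (r * \<bar>real_of_int n\<bar>)) * ((2 * exp r) ^ N * \<bar>t\<bar> ^ N / fact N)" for N
    proof -
      have "\<bar>(neighbour_sum ^^ N) f n\<bar> * (\<bar>t\<bar> ^ N / fact N)
          \<le> C * exp (r * \<bar>real_of_int n\<bar>) * (2 * exp r) ^ N * (\<bar>t\<bar> ^ N / fact N)"
        by (intro mult_right_mono neighbour_sum_power_bound f) auto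
      then show ?thesis by (simp add: abs_mult power_abs mult.assoc)
    qed
    have "\<bar>exp_series t (\<lambda>N. (neighbour_sum ^^ N) f n)\<bar>
      \<le> (\<Sum>N. (C * exp (r * \<bar>real_of_int n\<bar>)) * ((2 * exp r) ^ N * \<bar>t\<bar> ^ N / fact N))"
      using norm_suminf_le[OF le summable_mult[OF sum]] unfolding exp_series_def real_norm_def .
    also have "\<dots> = (C * exp (r * \<bar>real_of_int n\<bar>)) * s"
      unfolding s_def by (subst suminf_mult[OF sum]) simp
    finally show ?thesis
      unfolding heat_semigroup_series[OF assms] by (simp add: abs_mult mult_ac)
  qed
  with f(2) show ?thesis unfolding exp_growth_def by blast
qed

lemma heat_semigroup_deriv:
  assumes "exp_growth f"
  shows "((\<lambda>t. heat_semigroup t f n) has_real_derivative heat_semigroup t (laplacian f) n) (at t)"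
proof -
  obtain C r where f: "0 \<le> C" "0 \<le> r" "\<And>j. \<bar>f j\<bar> \<le> C * exp (r * \<bar>real_of_int j\<bar>)"
    using assms(1) by (rule exp_growthE) blast
  have "((\<lambda>t. exp (- 2 * t) * exp_series t (\<lambda>N. (neighbour_sum ^^ N) f n)) has_real_derivative
      exp (- 2 * t) * exp_series t (\<lambda>N. (neighbour_sum ^^ Suc N) f n)
      + (exp (- 2 * t) * (- 2)) * exp_series t (\<lambda>N. (neighbour_sum ^^ N) f n)) (at t)"
    by (rule DERIV_mult'[OF _ exp_series_deriv[OF neighbour_sum_power_bound[OF f(2,3)]]])
      (auto intro!: derivative_eq_intros)
  moreover have "heat_semigroup t (laplacian f) n
     = heat_semigroup t (neighbour_sum f) n - 2 * heat_semigroup t f n"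
    unfolding laplacian_eq
    by (subst heat_semigroup_diff)
      (auto simp: heat_semigroup_cmult intro: exp_growth_neighbour_sum exp_growth_cmult assms)
  moreover have "heat_semigroup t (neighbour_sum f) n
     = exp (- 2 * t) * exp_series t (\<lambda>N. (neighbour_sum ^^ Suc N) f n)"
    using heat_semigroup_series[OF exp_growth_neighbour_sum[OF assms]]
    by (simp add: funpow_swap1)
  ultimately show ?thesis
    using heat_semigroup_series[OF assms] by (simp add: mult_ac)
qed

text \<open>Iterated time derivatives are traded for iterated Laplacians; in this form the conditions defining
  \<open>Lambda_H\<close> are linear statements about values of the flow.\<close>

lemma heat_semigroup_higher_deriv:
  assumes "exp_growth f"
  shows "(deriv ^^ k) (\<lambda>s. heat_semigroup s f n) = (\<lambda>s. heat_semigroup s ((laplacian ^^ k) f) n)"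
proof (induction k)
  case (Suc k)
  have "exp_growth ((laplacian ^^ k) f)"
    by (rule exp_growth_funpow[OF exp_growth_laplacian assms])
  then have "deriv (\<lambda>s. heat_semigroup s ((laplacian ^^ k) f) n) t
      = heat_semigroup t ((laplacian ^^ Suc k) f) n" for t
    using heat_semigroup_deriv[of "(laplacian ^^ k) f"] by (simp add: DERIV_imp_deriv)
  with Suc show ?case by auto
qed simp

text \<open>The flow commutes with the neighbour sum, so the coefficients of the series for the outer flow are
  themselves values of the series for the inner flow.\<close>

lemma heat_semigroup_compose:
  assumes "exp_growth f"
  shows "heat_semigroup s (heat_semigroup t f) n = heat_semigroup (s + t) f n"
proof -
  obtain C r where f: "0 \<le> C" "0 \<le> r" "\<And>j. \<bar>f j\<bar> \<le> C * exp (r * \<bar>real_of_int j\<bar>)"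
    using assms(1) by (rule exp_growthE) blast
  note g = exp_growth_funpow[OF exp_growth_neighbour_sum assms]
  have "(neighbour_sum ^^ M) (heat_semigroup t f) n
      = exp (- 2 * t) * exp_series t (\<lambda>L. (neighbour_sum ^^ (M + L)) f n)" for M
  proof -
    have "(neighbour_sum ^^ M) (heat_semigroup t f) n = heat_semigroup t ((neighbour_sum ^^ M) f) n"
      using heat_semigroup_funpow[where D = neighbour_sum, OF exp_growth_neighbour_sum heat_semigroup_neighbour_sum assms]
      by simp
    also have "\<dots> = exp (- 2 * t) * exp_series t (\<lambda>L. (neighbour_sum ^^ L) ((neighbour_sum ^^ M) f) n)"
      by (rule heat_semigroup_series[OF g])
    finally show ?thesis by (simp add: add.commute[of M] funpow_add)
  qed
  then have "heat_semigroup s (heat_semigroup t f) n = exp (- 2 * s) *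
      (\<Sum>M. exp (- 2 * t) * (exp_series t (\<lambda>L. (neighbour_sum ^^ (M + L)) f n) * s ^ M / fact M))"
    by (simp add: heat_semigroup_series[OF exp_growth_heat_semigroup[OF assms]] exp_series_def[of s] mult.assoc)
  also have "\<dots> = exp (- 2 * s) * (exp (- 2 * t) * exp_series (s + t) (\<lambda>N. (neighbour_sum ^^ N) f n))"
    using sums_mult[OF exp_series_shift[OF neighbour_sum_power_bound[OF f(2,3)], where s = s and t = t],
        of "exp (- 2 * t)" n]
    by (simp add: sums_iff)
  finally show ?thesis
    by (simp add: heat_semigroup_series[OF assms] exp_add algebra_simps flip: exp_add)
qed

section \<open>Pointwise bounds for the heat kernel\<close>

lemma exp_growth_point_mass: "exp_growth (\<lambda>j. c * of_bool (j = i))"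
  by (rule exp_growth_bounded[where B = "\<bar>c\<bar>"]) auto

lemma heat_semigroup_point_mass:
  "heat_semigroup t (\<lambda>j. c * of_bool (j = i)) n = c * heat_kernel t (n - i)"
proof -
  have "((\<lambda>j. heat_kernel t (n - j) * (c * of_bool (j = i))) has_sum c * heat_kernel t (n - i)) UNIV"
    by (rule has_sum_finite_neutralI[of "{i}"]) auto
  then show ?thesis unfolding heat_semigroup_def by (rule infsumI)
qed

lemma heat_kernel_as_semigroup: "heat_kernel t n = heat_semigroup t (\<lambda>j. of_bool (j = 0)) n"
  using heat_semigroup_point_mass[of t 1 0 n] by simp

lemma heat_kernel_minus: "heat_kernel t (- m) = heat_kernel t m"
  by (simp add: heat_kernel_def besselI_def)

lemma heat_kernel_abs: "heat_kernel t \<bar>m\<bar> = heat_kernel t m"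
  by (simp add: heat_kernel_def besselI_def)

lemma heat_kernel_nonneg:
  assumes "0 \<le> t"
  shows "0 \<le> heat_kernel t m"
proof -
  define B where "B N = (neighbour_sum ^^ N) (\<lambda>j. of_bool (j = 0) :: real) m" for N
  have "0 \<le> B N" for N
    unfolding B_def neighbour_sum_power by (intro sum_nonneg) auto
  moreover have "\<bar>B N\<bar> \<le> 1 * 2 ^ N" for N
    using neighbour_sum_power_bound[where f = "\<lambda>j. of_bool (j = 0)" and C = 1 and r = 0 and n = m]
    by (simp add: B_def)
  ultimately have "0 \<le> exp_series t B"
    unfolding exp_series_def using assms
    by (intro suminf_nonneg exp_series_summable) (assumption, auto)
  then show ?thesis
    unfolding heat_kernel_as_semigroup
    by (subst heat_semigroup_series) (use exp_growth_point_mass[of 1 0] in \<open>auto simp: B_def[abs_def]\<close>)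
qed

lemma heat_semigroup_zero:
  assumes "exp_growth f"
  shows "heat_semigroup 0 f n = f n"
proof -
  have "exp_series 0 (\<lambda>N. (neighbour_sum ^^ N) f n) = f n"
    unfolding exp_series_def by (subst suminf_finite[of "{0}"]) auto
  then show ?thesis using heat_semigroup_series[OF assms, of 0 n] by simp
qed

lemma neighbour_sum_power_one: "(neighbour_sum ^^ N) (\<lambda>_. 1) n = 2 ^ N"
  by (induction N arbitrary: n) (auto simp: neighbour_sum_def)

text \<open>The neighbour sum maps \<open>j\<^sup>2\<close> to \<open>2 j\<^sup>2 + 2\<close>; this computes the second moment of the random walk.\<close>

lemma neighbour_sum_power_square:
  "(neighbour_sum ^^ N) (\<lambda>j. (real_of_int j)\<^sup>2) n = 2 ^ N * (real_of_int n)\<^sup>2 + real N * 2 ^ N"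
  by (induction N arbitrary: n)
    (simp_all add: neighbour_sum_def[of "(neighbour_sum ^^ _) _"] power2_eq_square algebra_simps)

lemma exp_series_geometric: "exp_series t (\<lambda>N. x ^ N) = exp (x * t)"
proof -
  have "(\<lambda>N. x ^ N * t ^ N / fact N) = (\<lambda>N. (x * t) ^ N /\<^sub>R fact N)"
    by (auto simp: power_mult_distrib divide_inverse mult_ac)
  then show ?thesis by (simp add: exp_series_def exp_def)
qed

lemma heat_semigroup_one: "heat_semigroup t (\<lambda>_. 1) n = 1"
  by (subst heat_semigroup_series)
    (auto intro: exp_growth_bounded[where B = 1]
      simp: neighbour_sum_power_one exp_series_geometric exp_minus)

lemma heat_kernel_sum: "((\<lambda>j. heat_kernel t (n - j)) has_sum 1) UNIV"
  using heat_semigroup_has_sum[OF exp_growth_bounded[where B = 1 and f = "\<lambda>_. 1"], of t n]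
  by (simp add: heat_semigroup_one)

lemma heat_kernel_le_1:
  assumes "0 \<le> t"
  shows "heat_kernel t m \<le> 1"
proof -
  have "sum (\<lambda>j. heat_kernel t (0 - j)) {-m} \<le> 1"
    by (rule finite_sum_le_has_sum[OF heat_kernel_sum[of t 0]]) (auto intro: heat_kernel_nonneg assms)
  then show ?thesis by simp
qed

lemma exp_growth_square: "exp_growth (\<lambda>j. (real_of_int j)\<^sup>2)"
  unfolding exp_growth_def
proof (rule exI[of _ 1], rule exI[of _ 2], intro conjI allI)
  fix j :: int
  have "\<bar>real_of_int j\<bar> \<le> exp \<bar>real_of_int j\<bar>"
    using exp_ge_add_one_self[of "\<bar>real_of_int j\<bar>"] by linarith
  then have "\<bar>real_of_int j\<bar>\<^sup>2 \<le> (exp \<bar>real_of_int j\<bar>)\<^sup>2" by (intro power_mono) auto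
  then show "\<bar>(real_of_int j)\<^sup>2\<bar> \<le> 1 * exp (2 * \<bar>real_of_int j\<bar>)"
    by (simp add: exp_double)
qed simp

lemma heat_semigroup_square: "heat_semigroup t (\<lambda>j. (real_of_int j)\<^sup>2) 0 = 2 * t"
proof -
  have "(\<lambda>N. real (Suc N) * 2 ^ Suc N * t ^ Suc N / fact (Suc N)) = (\<lambda>N. 2 * t * ((2 * t) ^ N /\<^sub>R fact N))"
  proof
    fix N
    have "real (Suc N) * 2 ^ Suc N * t ^ Suc N / fact (Suc N) = real (Suc N) * (2 * t) ^ Suc N / (real (Suc N) * fact N)"
      by (simp add: power_mult_distrib)
    also have "\<dots> = (2 * t) ^ Suc N / fact N"
      by (subst mult_divide_mult_cancel_left) auto
    finally show "real (Suc N) * 2 ^ Suc N * t ^ Suc N / fact (Suc N) = 2 * t * ((2 * t) ^ N /\<^sub>R fact N)"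
      by (simp add: divide_inverse mult_ac)
  qed
  moreover have "(\<lambda>N. 2 * t * ((2 * t) ^ N /\<^sub>R fact N)) sums (2 * t * exp (2 * t))"
    by (intro sums_mult exp_converges)
  ultimately have "(\<lambda>N. real N * 2 ^ N * t ^ N / fact N) sums (2 * t * exp (2 * t))"
    using sums_Suc_iff[of "\<lambda>N. real N * 2 ^ N * t ^ N / fact N" "2 * t * exp (2 * t)"] by simp
  then have "exp_series t (\<lambda>N. real N * 2 ^ N) = 2 * t * exp (2 * t)"
    unfolding exp_series_def by (simp add: sums_iff)
  then show ?thesis
    by (subst heat_semigroup_series[OF exp_growth_square])
      (simp add: neighbour_sum_power_square exp_minus)
qed

text \<open>The number of walks with \<open>N\<close> steps from the origin to \<open>n\<close> satisfies the termwise form of the Bessel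
  recurrence below. In terms of binomial coefficients it is \<open>(a - b) C(a + b, a) = (a + b) (C(a + b - 1, b) - C(a + b - 1, a))\<close>.\<close>

lemma neighbour_sum_power_recurrence:
  fixes n :: int
  defines "B \<equiv> \<lambda>N. (neighbour_sum ^^ N) (\<lambda>j. of_bool (j = 0) :: real)"
  shows "real_of_int n * B (Suc N) n = real (Suc N) * (B N (n - 1) - B N (n + 1))"
proof (induction N arbitrary: n)
  case 0
  then show ?case by (auto simp: B_def neighbour_sum_def)
next
  case (Suc N)
  have B: "B (Suc M) i = B M (i - 1) + B M (i + 1)" for M i
    by (simp add: B_def neighbour_sum_def)
  have "real_of_int n * B (Suc (Suc N)) n
    = real_of_int (n - 1) * B (Suc N) (n - 1) + real_of_int (n + 1) * B (Suc N) (n + 1)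
      + (B (Suc N) (n - 1) - B (Suc N) (n + 1))"
    by (simp add: B[of "Suc N"] algebra_simps)
  also have "\<dots> = real (Suc N) * (B N (n - 2) - B N (n + 2)) + (B (Suc N) (n - 1) - B (Suc N) (n + 1))"
    unfolding Suc.IH by (simp add: algebra_simps)
  also have "B N (n - 2) - B N (n + 2) = B (Suc N) (n - 1) - B (Suc N) (n + 1)"
    by (simp add: B add.commute)
  finally show ?case by (simp add: algebra_simps)
qed

text \<open>The recurrence \<open>2 n I\<^sub>n(x) = x (I\<^bsub>n-1\<^esub>(x) - I\<^bsub>n+1\<^esub>(x))\<close> at \<open>x = 2 t\<close>.\<close>

lemma heat_kernel_recurrence:
  "real_of_int n * heat_kernel t n = t * (heat_kernel t (n - 1) - heat_kernel t (n + 1))"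
proof -
  define B where "B N = (neighbour_sum ^^ N) (\<lambda>j. of_bool (j = 0) :: real)" for N
  have sm: "summable (\<lambda>N. B N i * t ^ N / fact N)" for i
    unfolding B_def
    by (rule exp_series_summable[OF neighbour_sum_power_bound[where C = 1 and r = 0]]) auto
  have p: "heat_kernel t i = exp (- 2 * t) * (\<Sum>N. B N i * t ^ N / fact N)" for i
    unfolding heat_kernel_as_semigroup
    by (subst heat_semigroup_series) (use exp_growth_point_mass[of 1 0] in \<open>auto simp: exp_series_def B_def\<close>)
  have eq: "real_of_int n * (B (Suc N) n * t ^ Suc N / fact (Suc N))
      = t * (B N (n - 1) * t ^ N / fact N - B N (n + 1) * t ^ N / fact N)" for N
  proof -
    have "real_of_int n * (B (Suc N) n * t ^ Suc N / fact (Suc N))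
        = (real_of_int n * B (Suc N) n) * t ^ Suc N / (real (Suc N) * fact N)" by simp
    also have "\<dots> = real (Suc N) * ((B N (n - 1) - B N (n + 1)) * t ^ Suc N) / (real (Suc N) * fact N)"
      unfolding neighbour_sum_power_recurrence[of n N, folded B_def] by (simp only: mult_ac)
    also have "\<dots> = ((B N (n - 1) - B N (n + 1)) * t ^ Suc N) / fact N"
      by (rule mult_divide_mult_cancel_left) simp
    finally show ?thesis by (simp add: diff_divide_distrib algebra_simps)
  qed
  have "real_of_int n * (\<Sum>N. B N n * t ^ N / fact N) = (\<Sum>N. real_of_int n * (B N n * t ^ N / fact N))"
    by (rule suminf_mult[OF sm, symmetric])
  also have "\<dots> = (\<Sum>N. real_of_int n * (B (Suc N) n * t ^ Suc N / fact (Suc N)))"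
    by (subst suminf_split_head[OF summable_mult[OF sm]]) (auto simp: B_def)
  also have "\<dots> = t * ((\<Sum>N. B N (n - 1) * t ^ N / fact N) - (\<Sum>N. B N (n + 1) * t ^ N / fact N))"
    unfolding eq by (simp add: suminf_mult suminf_diff sm summable_diff)
  finally have "exp (- 2 * t) * (real_of_int n * (\<Sum>N. B N n * t ^ N / fact N))
    = exp (- 2 * t) * (t * ((\<Sum>N. B N (n - 1) * t ^ N / fact N) - (\<Sum>N. B N (n + 1) * t ^ N / fact N)))"
    by simp
  then show ?thesis unfolding p by (simp only: right_diff_distrib mult_ac)
qed

lemma heat_kernel_deriv:
  "((\<lambda>t. heat_kernel t n) has_real_derivative
    heat_kernel t (n + 1) - 2 * heat_kernel t n + heat_kernel t (n - 1)) (at t)"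
  using heat_semigroup_deriv[OF exp_growth_point_mass[of 1 0], of n t]
  by (simp add: heat_semigroup_laplacian[OF exp_growth_point_mass[of 1 0, simplified]]
      laplacian_def flip: heat_kernel_as_semigroup)

text \<open>The recurrence turns the time derivative of \<open>exp (4 t) (p(t, n) - p(t, n + 1))\<close> into
  \<open>exp (4 t) / t\<close> times \<open>n p(t, n) + (n + 1) p(t, n + 1)\<close>, which is nonnegative for \<open>n \<ge> 0\<close>; at \<open>t = 0\<close> the
  kernel is the point mass at \<open>0\<close>, so the difference starts out nonnegative.\<close>

lemma heat_kernel_decreasing_step:
  assumes "0 \<le> n" "0 \<le> t"
  shows "heat_kernel t (n + 1) \<le> heat_kernel t n"
proof -
  define w where "w s = exp (4 * s) * (heat_kernel s n - heat_kernel s (n + 1))" for s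
  have w': "(w has_real_derivative exp (4 * s) * (4 * (heat_kernel s n - heat_kernel s (n + 1))
      + ((heat_kernel s (n + 1) - 2 * heat_kernel s n + heat_kernel s (n - 1))
        - (heat_kernel s (n + 2) - 2 * heat_kernel s (n + 1) + heat_kernel s n)))) (at s)" for s
  proof -
    have "((\<lambda>t. heat_kernel t (n + 1)) has_real_derivative
      heat_kernel s (n + 2) - 2 * heat_kernel s (n + 1) + heat_kernel s n) (at s)"
      using heat_kernel_deriv[of "n + 1" s] by (simp add: add.commute)
    then show ?thesis unfolding w_def
      by (auto intro!: derivative_eq_intros heat_kernel_deriv simp: algebra_simps)
  qed
  have "w 0 \<le> w t"
  proof (rule DERIV_nonneg_imp_increasing_open[OF assms(2)])
    show "continuous_on {0..t} w"
      by (intro DERIV_continuous_on) (auto intro: DERIV_subset[OF w'])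
    fix s assume s: "0 < s" "s < t"
    define D where "D = 4 * (heat_kernel s n - heat_kernel s (n + 1))
      + ((heat_kernel s (n + 1) - 2 * heat_kernel s n + heat_kernel s (n - 1))
        - (heat_kernel s (n + 2) - 2 * heat_kernel s (n + 1) + heat_kernel s n))"
    \<comment> \<open>Multiplying by \<open>s\<close> avoids dividing the recurrence by the time.\<close>
    have "s * D = s * (heat_kernel s (n - 1) - heat_kernel s (n + 1))
        + s * (heat_kernel s n - heat_kernel s (n + 2))"
      unfolding D_def by (simp add: algebra_simps)
    also have "\<dots> = real_of_int n * heat_kernel s n + real_of_int (n + 1) * heat_kernel s (n + 1)"
      using heat_kernel_recurrence[of n s] heat_kernel_recurrence[of "n + 1" s] by (simp add: add.commute[of 2])
    also have "\<dots> \<ge> 0"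
      using assms(1) s by (intro add_nonneg_nonneg mult_nonneg_nonneg heat_kernel_nonneg) auto
    finally have "0 \<le> D" using s by (simp add: zero_le_mult_iff)
    then show "\<exists>y. (w has_real_derivative y) (at s) \<and> 0 \<le> y"
      using w'[of s] unfolding D_def by (intro exI conjI) (assumption, simp)
  qed
  moreover have "0 \<le> w 0"
    using assms(1) heat_semigroup_zero[OF exp_growth_point_mass[of 1 0]]
    by (simp add: w_def heat_kernel_as_semigroup)
  ultimately have "0 \<le> w t" by linarith
  then show ?thesis by (simp add: w_def zero_le_mult_iff)
qed

lemma heat_kernel_antimono:
  assumes "0 \<le> t" "\<bar>i\<bar> \<le> \<bar>j\<bar>"
  shows "heat_kernel t j \<le> heat_kernel t i"
proof -
  have "heat_kernel t (\<bar>i\<bar> + int k) \<le> heat_kernel t \<bar>i\<bar>" for k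
  proof (induction k)
    case (Suc k)
    have "heat_kernel t (\<bar>i\<bar> + int (Suc k)) \<le> heat_kernel t (\<bar>i\<bar> + int k)"
      using heat_kernel_decreasing_step[of "\<bar>i\<bar> + int k" t] assms(1) by (simp add: add_ac)
    with Suc show ?case by simp
  qed simp
  from this[of "nat (\<bar>j\<bar> - \<bar>i\<bar>)"] assms(2) show ?thesis by (simp add: heat_kernel_abs)
qed

text \<open>The form of the central binomial estimate that is preserved by induction, because
  \<open>(2 m + 1) (2 m + 3) \<le> 4 (m + 1)\<^sup>2\<close>.\<close>

lemma central_binomial_bound: "real (2 * m + 1) * (real ((2 * m) choose m))\<^sup>2 \<le> 16 ^ m"
proof (induction m)
  case (Suc m)
  define c where "c = real ((2 * m) choose m)"
  have c: "real ((2 * Suc m) choose Suc m) * real (Suc m) = 2 * real (2 * m + 1) * c"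
  proof -
    define k d where "k = real (Suc m)" and "d = real (2 * m + 1)"
    have b: "real ((2 * Suc m) choose Suc m) = fact (2 * Suc m) / (fact (Suc m) * fact (Suc m))"
      using binomial_fact[of "Suc m" "2 * Suc m", where 'a = real]
      by (simp only: mult_2 diff_add_inverse le_add1)
    have c: "c = fact (2 * m) / (fact m * fact m)"
      using binomial_fact[of m "2 * m", where 'a = real]
      by (simp only: c_def mult_2 diff_add_inverse le_add1)
    have "(fact (2 * Suc m) :: real) = (2 * k) * (d * fact (2 * m))" "(fact (Suc m) :: real) = k * fact m"
      by (simp_all add: k_def d_def algebra_simps)
    then have "real ((2 * Suc m) choose Suc m) * k = 2 * d * c"
      unfolding b c by (simp add: field_simps k_def del: of_nat_Suc fact_Suc)
    then show ?thesis unfolding k_def d_def .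
  qed
  have "real (2 * Suc m + 1) * (real ((2 * Suc m) choose Suc m))\<^sup>2 * (real (Suc m))\<^sup>2
      = real (2 * m + 3) * (real ((2 * Suc m) choose Suc m) * real (Suc m))\<^sup>2"
    by (simp add: power_mult_distrib)
  also have "\<dots> = (4 * (real (2 * m + 3) * real (2 * m + 1))) * (real (2 * m + 1) * c\<^sup>2)"
    unfolding c by (simp only: power_mult_distrib) (simp add: power2_eq_square)
  also have "\<dots> \<le> (16 * (real (Suc m))\<^sup>2) * 16 ^ m"
    by (rule mult_mono) (use Suc.IH in \<open>auto simp: c_def power2_eq_square algebra_simps\<close>)
  also have "\<dots> = 16 ^ Suc m * (real (Suc m))\<^sup>2" by simp
  finally show ?case by (rule mult_right_le_imp_le) simp
qed simp

text \<open>The return probability is a Poisson average of \<open>C(2 m, m) / 4 ^ m \<le> 1 / sqrt (2 m + 1)\<close>. As the Poisson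
  weights concentrate at \<open>2 m\<close> of order \<open>t\<close>, the inequality of arithmetic and geometric means in the form
  \<open>1 / sqrt q \<le> sqrt t / (2 q) + 1 / (2 sqrt t)\<close> loses only a constant, and it leaves two averages that
  are explicit hyperbolic functions.\<close>

lemma heat_kernel_0_bound:
  assumes "0 < t"
  shows "heat_kernel t 0 \<le> 1 / sqrt t"
proof -
  have sinh: "(\<lambda>n. if even n then 0 else (2 * t) ^ n /\<^sub>R fact n) sums sinh (2 * t)" 
    and cosh: "(\<lambda>n. if even n then (2 * t) ^ n /\<^sub>R fact n else 0) sums cosh (2 * t)"
    by (rule sinh_converges, rule cosh_converges)
  have S: "(\<lambda>m. (2 * t) ^ (2 * m + 1) / fact (2 * m + 1)) sums sinh (2 * t)"
  proof -
    have "(\<lambda>m. if even (2 * m + 1) then 0 else (2 * t) ^ (2 * m + 1) /\<^sub>R fact (2 * m + 1)) sums sinh (2 * t)"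
      using sums_mono_reindex[of "\<lambda>m. 2 * m + 1" "\<lambda>n. if even n then 0 else (2 * t) ^ n /\<^sub>R fact n" "sinh (2 * t)"] sinh
      by (force simp: strict_mono_def elim!: oddE)
    then show ?thesis by (simp add: divide_inverse mult.commute)
  qed
  have C: "(\<lambda>m. (2 * t) ^ (2 * m) / fact (2 * m)) sums cosh (2 * t)"
  proof -
    have "(\<lambda>m. if even (2 * m) then (2 * t) ^ (2 * m) /\<^sub>R fact (2 * m) else 0) sums cosh (2 * t)"
      using sums_mono_reindex[of "\<lambda>m. 2 * m" "\<lambda>n. if even n then (2 * t) ^ n /\<^sub>R fact n else 0" "cosh (2 * t)"] cosh
      by (force simp: strict_mono_def elim!: evenE)
    then show ?thesis by (simp add: divide_inverse mult.commute)
  qed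
  define u where "u m = 1 / (4 * sqrt t) * ((2 * t) ^ (2 * m + 1) / fact (2 * m + 1)) + 1 / (2 * sqrt t) * ((2 * t) ^ (2 * m) / fact (2 * m))" for m :: nat
  have u: "u sums (1 / (4 * sqrt t) * sinh (2 * t) + 1 / (2 * sqrt t) * cosh (2 * t))"
    unfolding u_def by (intro sums_add sums_mult S C)
  have le: "t ^ m / fact m * (t ^ m / fact m) \<le> u m" for m
  proof -
    define q where "q = real (2 * m + 1)"
    have q: "0 < q" by (simp add: q_def)
    have "(sqrt q * real ((2 * m) choose m))\<^sup>2 \<le> (4 ^ m)\<^sup>2"
    proof -
      have "(4 ^ m)\<^sup>2 = (16 ^ m :: real)"
        by (subst power_mult[symmetric], subst mult.commute) (simp add: power_mult)
      then show ?thesis using central_binomial_bound[of m] q by (simp add: q_def power_mult_distrib)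
    qed
    then have "sqrt q * real ((2 * m) choose m) \<le> 4 ^ m"
      by (rule power2_le_imp_le) simp
    then have "real ((2 * m) choose m) \<le> 4 ^ m * (1 / sqrt q)"
      using q by (simp add: field_simps)
    also have "1 / sqrt q \<le> sqrt t / (2 * q) + 1 / (2 * sqrt t)"
    proof -
      have "0 \<le> (sqrt t - sqrt q)\<^sup>2 / (2 * sqrt t * q)"
        using assms q by simp
      also have "\<dots> = sqrt t / (2 * q) + 1 / (2 * sqrt t) - 1 / sqrt q"
        using assms q by (simp add: power2_diff field_simps)
      finally show ?thesis by simp
    qed
    finally have b: "real ((2 * m) choose m) \<le> 4 ^ m * (sqrt t / (2 * q) + 1 / (2 * sqrt t))" by simp
    have "t ^ m / fact m * (t ^ m / fact m) = real ((2 * m) choose m) * (t ^ (2 * m) / fact (2 * m))"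
      using binomial_fact[of m "2 * m", where 'a = real]
      by (simp add: mult_2 power_add)
    also have "\<dots> \<le> 4 ^ m * (sqrt t / (2 * q) + 1 / (2 * sqrt t)) * (t ^ (2 * m) / fact (2 * m))"
      using assms by (intro mult_right_mono b) auto
    also have "\<dots> = u m"
    proof -
      have f: "(fact (2 * m + 1) :: real) = q * fact (2 * m)" by (simp add: q_def)
      have p: "(2 * t) ^ (2 * m) = 4 ^ m * t ^ (2 * m)" by (simp add: power_mult_distrib power_mult)
      have "t = sqrt t * sqrt t" using assms by simp
      then have r: "1 / (4 * sqrt t) * (2 * t) = sqrt t / 2" using assms by (simp add: field_simps)
      have "1 / (4 * sqrt t) * ((2 * t) ^ (2 * m + 1) / fact (2 * m + 1))
          = (1 / (4 * sqrt t) * (2 * t)) * ((2 * t) ^ (2 * m) / (q * fact (2 * m)))"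
        unfolding f by simp
      then have "u m = sqrt t / 2 * ((2 * t) ^ (2 * m) / (q * fact (2 * m)))
          + 1 / (2 * sqrt t) * ((2 * t) ^ (2 * m) / fact (2 * m))"
        unfolding u_def r by (simp only:)
      then have "u m = sqrt t / (2 * q) * (4 ^ m * t ^ (2 * m) / fact (2 * m))
          + 1 / (2 * sqrt t) * (4 ^ m * t ^ (2 * m) / fact (2 * m))"
        unfolding p by (simp add: mult_ac)
      also have "\<dots> = (sqrt t / (2 * q) + 1 / (2 * sqrt t)) * (4 ^ m * t ^ (2 * m) / fact (2 * m))"
        by (rule distrib_right[symmetric])
      finally show ?thesis by simp
    qed
    finally show ?thesis .
  qed
  have sm: "summable (\<lambda>m. t ^ m / fact m * (t ^ m / fact m))"
    by (rule summable_comparison_test'[OF sums_summable[OF u]]) (use le assms in auto)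
  have "(\<Sum>m. t ^ m / fact m * (t ^ m / fact m)) \<le> 1 / (4 * sqrt t) * sinh (2 * t) + 1 / (2 * sqrt t) * cosh (2 * t)"
    using suminf_le[OF le sm sums_summable[OF u]] u by (simp add: sums_iff)
  also have "\<dots> \<le> 1 / (4 * sqrt t) * exp (2 * t) + 1 / (2 * sqrt t) * exp (2 * t)"
  proof -
    have half: "(x - y) / 2 \<le> x \<and> (x + y) / 2 \<le> x" if "0 \<le> y" "y \<le> x" for x y :: real
      using that by auto
    have "exp (- (2 * t)) \<le> exp (2 * t)" "0 \<le> exp (- (2 * t))" using assms by auto
    then have "sinh (2 * t) \<le> exp (2 * t)" "cosh (2 * t) \<le> exp (2 * t)"
      using half[of "exp (- (2 * t))" "exp (2 * t)"] unfolding sinh_field_def cosh_field_def by auto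
    then show ?thesis using assms by (intro add_mono mult_left_mono) auto
  qed
  also have "\<dots> \<le> 1 / sqrt t * exp (2 * t)"
    using assms by (simp add: field_simps)
  finally have "exp (- 2 * t) * (\<Sum>m. t ^ m / fact m * (t ^ m / fact m)) \<le> exp (- 2 * t) * (1 / sqrt t * exp (2 * t))"
    by (intro mult_left_mono) auto
  then show ?thesis by (simp add: heat_kernel_poisson_product exp_minus)
qed

text \<open>A Chebyshev bound sharpened by monotonicity: if \<open>p(t, m)\<close> were larger, all the values
  \<open>p(t, 1), \<dots>, p(t, m)\<close> would be, and already they would exceed the second moment \<open>2 t\<close>.\<close>

lemma heat_kernel_far_bound:
  assumes "0 \<le> t" "m \<noteq> 0"
  shows "heat_kernel t m \<le> 6 * t / \<bar>real_of_int m\<bar> ^ 3"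
proof -
  define N where "N = nat \<bar>m\<bar>"
  have cube: "real k ^ 3 / 3 \<le> (\<Sum>j=1..k. (real j)\<^sup>2)" for k
    by (induction k) (auto simp: power3_eq_cube power2_eq_square algebra_simps)
  have "heat_kernel t m * (real N ^ 3 / 3) \<le> heat_kernel t m * (\<Sum>j=1..N. (real j)\<^sup>2)"
    by (intro mult_left_mono cube heat_kernel_nonneg assms)
  also have "\<dots> \<le> (\<Sum>j=1..N. heat_kernel t (int j) * (real j)\<^sup>2)"
    unfolding sum_distrib_left
    by (intro sum_mono mult_right_mono heat_kernel_antimono) (use assms in \<open>auto simp: N_def\<close>)
  also have "\<dots> = (\<Sum>j\<in>int ` {1..N}. heat_kernel t (0 - j) * (real_of_int j)\<^sup>2)"
    by (subst sum.reindex) (auto simp: heat_kernel_minus)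
  also have "\<dots> \<le> 2 * t"
    using heat_semigroup_has_sum[OF exp_growth_square, of t 0]
    by (intro finite_sum_le_has_sum[where A = UNIV])
      (auto simp: heat_semigroup_square intro!: mult_nonneg_nonneg heat_kernel_nonneg assms)
  finally show ?thesis using assms(2) by (simp add: N_def field_simps)
qed

section \<open>Smoothing on bounded sequences\<close>

text \<open>Summation by parts leaves the total variation of the kernel. It is computed without telescoping:
  by monotonicity it is the flow of the first difference of a sign function \<open>\<sigma>\<close>, and
  that difference is twice a point mass.\<close>

lemma heat_semigroup_forward_diff_bound:
  assumes "0 \<le> t" "\<And>j. \<bar>g j\<bar> \<le> B"
  shows "\<bar>heat_semigroup t (forward_diff g) n\<bar> \<le> 2 * heat_kernel t 0 * B"
proof -
  define \<sigma> where "\<sigma> j = (if j \<le> n then - 1 else 1 :: real)" for j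
  have repr: "((\<lambda>j. (heat_kernel t (n + 1 - j) - heat_kernel t (n - j)) * h j) has_sum
      heat_semigroup t (forward_diff h) n) UNIV" if "exp_growth h" for h
    using has_sum_add[OF heat_semigroup_has_sum[OF that, of t "n + 1"]
        has_sum_cmult_right[OF heat_semigroup_has_sum[OF that, of t n], where c = "- 1"]]
    by (simp add: heat_semigroup_forward_diff[OF that] forward_diff_def left_diff_distrib)
  have \<sigma>: "exp_growth \<sigma>" by (rule exp_growth_bounded[where B = 1]) (simp add: \<sigma>_def)
  have "heat_semigroup t (forward_diff \<sigma>) n = 2 * heat_kernel t 0"
  proof -
    have "forward_diff \<sigma> = (\<lambda>j. 2 * of_bool (j = n))" by (auto simp: forward_diff_def \<sigma>_def)
    then show ?thesis using heat_semigroup_point_mass[of t 2 n n] by simp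
  qed
  with repr[OF \<sigma>] have S: "((\<lambda>j. (heat_kernel t (n + 1 - j) - heat_kernel t (n - j)) * \<sigma> j * B) has_sum
      2 * heat_kernel t 0 * B) UNIV"
    by (intro has_sum_cmult_left) simp
  have abs: "\<bar>heat_kernel t (n + 1 - j) - heat_kernel t (n - j)\<bar>
      = (heat_kernel t (n + 1 - j) - heat_kernel t (n - j)) * \<sigma> j" for j
  proof (cases "j \<le> n")
    case True
    then show ?thesis using heat_kernel_antimono[OF assms(1), of "n - j" "n + 1 - j"] by (simp add: \<sigma>_def)
  next
    case False
    then show ?thesis using heat_kernel_antimono[OF assms(1), of "n + 1 - j" "n - j"] by (simp add: \<sigma>_def)
  qed
  have "norm (heat_semigroup t (forward_diff g) n) \<le> 2 * heat_kernel t 0 * B"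
  proof (rule norm_infsum_le[OF repr S])
    show "exp_growth g" using assms(2) by (rule exp_growth_bounded)
    show "norm ((heat_kernel t (n + 1 - j) - heat_kernel t (n - j)) * g j)
      \<le> (heat_kernel t (n + 1 - j) - heat_kernel t (n - j)) * \<sigma> j * B" for j
      unfolding abs[symmetric] real_norm_def abs_mult by (intro mult_left_mono assms) auto
  qed
  then show ?thesis by simp
qed

text \<open>The Laplacian factors into two first differences. Running the flow for time \<open>t / 2\<close> twice, each
  run absorbs one difference at the price \<open>2 p(t / 2, 0)\<close>, hence both at the price of a multiple of \<open>1 / t\<close>.\<close>

lemma heat_semigroup_laplacian_bound:
  assumes "0 < t" "\<And>j. \<bar>g j\<bar> \<le> B"
  shows "\<bar>heat_semigroup t (laplacian g) n\<bar> \<le> 8 * B / t"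
proof -
  define h where "h j = g (j - 1)" for j
  have g: "exp_growth h"
    using assms(2) by (intro exp_growth_bounded[where B = B]) (simp add: h_def)
  have B: "0 \<le> B" using assms(2)[of 0] by linarith
  have h: "\<bar>h j\<bar> \<le> B" for j using assms(2) by (simp add: h_def)
  have "laplacian g = forward_diff (forward_diff h)"
    by (auto simp: laplacian_def forward_diff_def h_def algebra_simps)
  then have "heat_semigroup t (laplacian g) n
      = heat_semigroup (t / 2) (heat_semigroup (t / 2) (forward_diff (forward_diff h))) n"
    using heat_semigroup_compose[OF exp_growth_forward_diff[OF exp_growth_forward_diff[OF g]], of "t / 2" "t / 2" n]
    by simp
  also have "\<dots> = heat_semigroup (t / 2) (forward_diff (heat_semigroup (t / 2) (forward_diff h))) n"
    by (simp add: heat_semigroup_forward_diff[OF exp_growth_forward_diff[OF g]])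
  also have "\<bar>\<dots>\<bar> \<le> 2 * heat_kernel (t / 2) 0 * (2 * heat_kernel (t / 2) 0 * B)"
    by (intro heat_semigroup_forward_diff_bound h) (use assms(1) in auto)
  also have "\<dots> = 4 * B * (heat_kernel (t / 2) 0)\<^sup>2" by (simp add: power2_eq_square)
  also have "\<dots> \<le> 4 * B * (1 / sqrt (t / 2))\<^sup>2"
    using assms(1) B heat_kernel_0_bound[of "t / 2"] heat_kernel_nonneg[of "t / 2" 0]
    by (intro mult_left_mono power_mono) auto
  also have "\<dots> = 8 * B / t"
    using assms(1) by (simp add: power_divide)
  finally show ?thesis .
qed

section \<open>Time integrals of sums and of powers\<close>

lemma summable_on_iff_integrable_count_space:
  fixes f :: "'i \<Rightarrow> real"
  shows "f summable_on UNIV \<longleftrightarrow> integrable (count_space UNIV) f"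
  using summable_on_iff_abs_summable_on_real[of f UNIV] abs_summable_equivalent[of f UNIV]
  by (simp add: Infinite_Set_Sum.abs_summable_on_def)

lemma infsum_eq_integral_count_space:
  fixes f :: "'i \<Rightarrow> real"
  assumes "f summable_on UNIV"
  shows "(\<Sum>\<^sub>\<infinity>i. f i) = (\<integral>i. f i \<partial>count_space UNIV)"
  using assms infsetsum_infsum[of f UNIV]
  by (simp add: summable_on_iff_integrable_count_space Infinite_Set_Sum.abs_summable_on_def infsetsum_def)

text \<open>Fubini for the counting measure and Lebesgue measure. The pointwise summability makes the sum
  of the integrand meaningful at every point of \<open>A\<close> instead of almost everywhere.\<close>

lemma set_integral_infsum:
  fixes \<phi> :: "'i :: countable \<Rightarrow> real \<Rightarrow> real"
  assumes int: "\<And>i. set_integrable lborel A (\<phi> i)"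
    and sum: "(\<lambda>i. LBINT x:A. \<bar>\<phi> i x\<bar>) summable_on UNIV"
    and pointwise: "\<And>x. x \<in> A \<Longrightarrow> (\<lambda>i. \<phi> i x) summable_on UNIV"
  shows "set_integrable lborel A (\<lambda>x. \<Sum>\<^sub>\<infinity>i. \<phi> i x)"
    and "((\<lambda>i. LBINT x:A. \<phi> i x) has_sum (LBINT x:A. \<Sum>\<^sub>\<infinity>i. \<phi> i x)) UNIV"
proof -
  define F where "F i x = indicator A x *\<^sub>R \<phi> i x" for i x
  interpret pair_sigma_finite "count_space (UNIV :: 'i set)" "lborel :: real measure"
    by (rule pair_sigma_finite.intro[OF sigma_finite_measure_count_space lborel.sigma_finite_measure_axioms])
  have F: "integrable lborel (F i)" for i
    using int[of i] by (simp add: set_integrable_def F_def[abs_def])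
  have normF: "(\<integral>x. norm (F i x) \<partial>lborel) = (LBINT x:A. \<bar>\<phi> i x\<bar>)" for i
    unfolding set_lebesgue_integral_def F_def
    by (intro Bochner_Integration.integral_cong) (auto split: split_indicator)
  have prod: "integrable (count_space UNIV \<Otimes>\<^sub>M lborel) (case_prod F)"
  proof (rule Fubini_integrable)
    show "case_prod F \<in> borel_measurable (count_space UNIV \<Otimes>\<^sub>M lborel)"
      using F by (intro measurable_pair_measure_countable1) auto
    show "integrable (count_space UNIV) (\<lambda>i. \<integral>x. norm (case (i, x) of (i, x) \<Rightarrow> F i x) \<partial>lborel)"
      using sum by (simp add: normF[unfolded real_norm_def] summable_on_iff_integrable_count_space)
    show "AE i in count_space UNIV. integrable lborel (\<lambda>x. case (i, x) of (i, x) \<Rightarrow> F i x)"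
      using F by simp
  qed
  have inner: "(\<integral>i. F i x \<partial>count_space UNIV) = indicator A x *\<^sub>R (\<Sum>\<^sub>\<infinity>i. \<phi> i x)" for x
  proof (cases "x \<in> A")
    case True
    then show ?thesis
      using infsum_eq_integral_count_space[OF pointwise[OF True]] by (simp add: F_def)
  qed (simp add: F_def)
  show "set_integrable lborel A (\<lambda>x. \<Sum>\<^sub>\<infinity>i. \<phi> i x)"
    using integrable_snd[OF prod] by (simp add: inner set_integrable_def)
  have 1: "(LBINT x:A. \<Sum>\<^sub>\<infinity>i. \<phi> i x) = (\<integral>i. (\<integral>x. F i x \<partial>lborel) \<partial>count_space UNIV)"
    using Fubini_integral[OF prod] by (simp add: inner set_lebesgue_integral_def)
  have eq: "(\<integral>x. F i x \<partial>lborel) = (LBINT x:A. \<phi> i x)" for i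
    by (simp add: F_def[abs_def] set_lebesgue_integral_def)
  have "(\<lambda>i. LBINT x:A. \<phi> i x) summable_on UNIV"
    using integrable_fst[OF prod] by (simp add: summable_on_iff_integrable_count_space eq)
  moreover from infsum_eq_integral_count_space[OF this]
  have "(\<Sum>\<^sub>\<infinity>i. LBINT x:A. \<phi> i x) = (LBINT x:A. \<Sum>\<^sub>\<infinity>i. \<phi> i x)"
    using 1 by (simp add: eq)
  ultimately show "((\<lambda>i. LBINT x:A. \<phi> i x) has_sum (LBINT x:A. \<Sum>\<^sub>\<infinity>i. \<phi> i x)) UNIV"
    by (metis has_sum_infsum)
qed

text \<open>Transfers the gauge integrals of power functions over unbounded or singular ranges to Lebesgue integrals.\<close>

lemma has_bochner_integral_of_has_integral:
  fixes h :: "real \<Rightarrow> real"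
  assumes "(h has_integral I) S" "\<And>x. x \<in> S \<Longrightarrow> 0 \<le> h x" "h \<in> borel_measurable borel" "S \<in> sets borel"
  shows "has_bochner_integral lborel (\<lambda>x. indicator S x * h x) I"
proof (rule has_bochner_integral_nn_integral)
  show "(\<integral>\<^sup>+ x. ennreal (indicator S x * h x) \<partial>lborel) = ennreal I"
    using nn_integral_has_integral_lebesgue[OF assms(2,1)] by simp
  show "0 \<le> I" using has_integral_nonneg[OF assms(1,2)] .
qed (use assms in \<open>auto split: split_indicator\<close>)

text \<open>The shape of all time integrals that occur here: an integrable singularity at \<open>0\<close> and
  an integrable tail, with a crossover at \<open>T\<close>.\<close>

lemma set_integral_two_powers:
  fixes h :: "real \<Rightarrow> real"
  assumes T: "0 < T" and a: "0 < a" and b: "0 < b" and AB: "0 \<le> A" "0 \<le> B"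
    and meas: "h \<in> borel_measurable borel"
    and near: "\<And>x. 0 < x \<Longrightarrow> x \<le> T \<Longrightarrow> \<bar>h x\<bar> \<le> A * x powr (a - 1)"
    and far: "\<And>x. T < x \<Longrightarrow> \<bar>h x\<bar> \<le> B * x powr (- b - 1)"
  shows "set_integrable lborel {0<..} h"
    and "(LBINT x:{0<..}. \<bar>h x\<bar>) \<le> A * T powr a / a + B * T powr (- b) / b"
proof -
  \<comment> \<open>Both ranges include \<open>T\<close>; the overlap only enlarges the majorant.\<close>
  define g where "g x = A * (indicator {0..T} x * x powr (a - 1)) + B * (indicator {T..} x * x powr (- b - 1))" for x
  have "((\<lambda>x. x powr (a - 1)) has_integral (T powr a / a)) {0..T}"
    using has_integral_powr_from_0[of "a - 1" T] a T by simp
  then have 1: "has_bochner_integral lborel (\<lambda>x. indicator {0..T} x * x powr (a - 1)) (T powr a / a)"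
    by (rule has_bochner_integral_of_has_integral) auto
  have "((\<lambda>x. x powr (- b - 1)) has_integral (T powr (- b) / b)) {T..}"
    using has_integral_powr_to_inf[of "- b - 1" T] b T by simp
  then have 2: "has_bochner_integral lborel (\<lambda>x. indicator {T..} x * x powr (- b - 1)) (T powr (- b) / b)"
    by (rule has_bochner_integral_of_has_integral) auto
  have g: "has_bochner_integral lborel g (A * (T powr a / a) + B * (T powr (- b) / b))"
    unfolding g_def[abs_def]
    by (intro has_bochner_integral_add has_bochner_integral_mult_right 1 2)
  have le: "\<bar>indicator {0<..} x * h x\<bar> \<le> g x" for x
  proof -
    have "0 \<le> A * (indicator {0..T} x * x powr (a - 1))" "0 \<le> B * (indicator {T..} x * x powr (- b - 1))"
      using AB by auto
    then show ?thesis
      using near[of x] far[of x] unfolding g_def by (auto simp: indicator_def split: if_splits)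
  qed
  show int: "set_integrable lborel {0<..} h"
    unfolding set_integrable_def
  proof (rule Bochner_Integration.integrable_bound)
    show "integrable lborel g" using g by (rule integrable.intros)
    show "AE x in lborel. norm (indicat_real {0<..} x *\<^sub>R h x) \<le> norm (g x)"
      using le by (auto intro!: AE_I2 order_trans[OF le])
  qed (use meas in simp)
  have "(LBINT x:{0<..}. \<bar>h x\<bar>) \<le> integral\<^sup>L lborel g"
    unfolding set_lebesgue_integral_def
  proof (rule integral_mono)
    show "integrable lborel (\<lambda>x. indicat_real {0<..} x *\<^sub>R \<bar>h x\<bar>)"
      using set_integrable_abs[OF int] by (simp add: set_integrable_def)
    show "integrable lborel g" using g by (rule integrable.intros)
    show "indicat_real {0<..} x *\<^sub>R \<bar>h x\<bar> \<le> g x" for x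
      using le[of x] by (auto simp: abs_mult)
  qed
  also have "\<dots> = A * T powr a / a + B * T powr (- b) / b"
    using has_bochner_integral_integral_eq[OF g] by simp
  finally show "(LBINT x:{0<..}. \<bar>h x\<bar>) \<le> A * T powr a / a + B * T powr (- b) / b" .
qed

section \<open>Power weights on the integers\<close>

lemma one_plus_powr_le_exp:
  fixes x a :: real
  assumes "0 \<le> x" "0 \<le> a"
  shows "(1 + x) powr a \<le> exp (a * x)"
proof -
  have "(1 + x) powr a \<le> exp x powr a"
    using assms by (intro powr_mono2) auto
  then show ?thesis by (simp add: powr_def mult.commute)
qed

lemma exp_growth_polynomial:
  assumes "0 \<le> a" "\<And>j. \<bar>f j\<bar> \<le> C * (1 + \<bar>real_of_int j\<bar>) powr a"
  shows "exp_growth f"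
  unfolding exp_growth_def
proof (rule exI[of _ C], rule exI[of _ a], intro conjI allI)
  fix j
  have "0 \<le> C" using assms(2)[of 0] by simp
  then have "C * (1 + \<bar>real_of_int j\<bar>) powr a \<le> C * exp (a * \<bar>real_of_int j\<bar>)"
    using assms(1) by (intro mult_left_mono one_plus_powr_le_exp) auto
  with assms(2)[of j] show "\<bar>f j\<bar> \<le> C * exp (a * \<bar>real_of_int j\<bar>)" by linarith
qed fact

text \<open>Peetre's inequality: moving the centre of the weight from \<open>n\<close> to \<open>0\<close> costs a power of \<open>1 + \<bar>n\<bar>\<close>.\<close>

lemma weight_shift:
  fixes n j :: int
  assumes "\<gamma> \<le> 1"
  shows "(1 + \<bar>real_of_int (n - j)\<bar>) powr (\<gamma> - 1)
    \<le> (1 + \<bar>real_of_int n\<bar>) powr (1 - \<gamma>) * (1 + \<bar>real_of_int j\<bar>) powr (\<gamma> - 1)"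
proof -
  have "1 + \<bar>real_of_int j\<bar> \<le> 1 + \<bar>real_of_int n\<bar> + \<bar>real_of_int (n - j)\<bar>"
    by linarith
  also have "\<dots> \<le> (1 + \<bar>real_of_int n\<bar>) * (1 + \<bar>real_of_int (n - j)\<bar>)"
    by (simp add: algebra_simps)
  finally have "(1 + \<bar>real_of_int j\<bar>) powr (1 - \<gamma>)
      \<le> ((1 + \<bar>real_of_int n\<bar>) * (1 + \<bar>real_of_int (n - j)\<bar>)) powr (1 - \<gamma>)"
    using assms by (intro powr_mono2) auto
  also have "\<dots> = (1 + \<bar>real_of_int n\<bar>) powr (1 - \<gamma>) * (1 + \<bar>real_of_int (n - j)\<bar>) powr (1 - \<gamma>)"
    by (rule powr_mult)
  finally have *: "(1 + \<bar>real_of_int j\<bar>) powr (1 - \<gamma>)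
    \<le> (1 + \<bar>real_of_int n\<bar>) powr (1 - \<gamma>) * (1 + \<bar>real_of_int (n - j)\<bar>) powr (1 - \<gamma>)" .
  have inv: "x powr (\<gamma> - 1) = 1 / x powr (1 - \<gamma>)" for x :: real
    using powr_minus_divide[of x "1 - \<gamma>"] by simp
  have "1 + \<bar>real_of_int j\<bar> > 0" "1 + \<bar>real_of_int (n - j)\<bar> > 0" by auto
  with * show ?thesis unfolding inv by (simp add: field_simps)
qed

text \<open>The exponent lies between \<open>- 1\<close> and \<open>0\<close>, so halving the argument costs at most a factor \<open>2\<close>.\<close>

lemma powr_half_le:
  fixes x y :: real
  assumes "0 \<le> \<gamma>" "\<gamma> \<le> 1" "0 < x" "x / 2 \<le> y"
  shows "y powr (\<gamma> - 1) \<le> 2 * x powr (\<gamma> - 1)"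
proof -
  have "y powr (\<gamma> - 1) \<le> (x / 2) powr (\<gamma> - 1)"
    using assms by (intro powr_mono2') auto
  also have "\<dots> = x powr (\<gamma> - 1) * 2 powr (1 - \<gamma>)"
    using assms powr_minus_divide[of 2 "\<gamma> - 1"] by (simp add: powr_divide)
  also have "\<dots> \<le> x powr (\<gamma> - 1) * 2 powr 1"
    using assms by (intro mult_left_mono powr_mono) auto
  finally show ?thesis by simp
qed

text \<open>The discrete analogue of \<open>\<integral> x powr (\<gamma> - 1) dx = x powr \<gamma> / \<gamma>\<close>. The increment of
  \<open>N powr \<gamma>\<close> is compared with its derivative at the right end point by means of Young's inequality.\<close>

lemma sum_powr_le:
  fixes \<gamma> :: real
  assumes "0 < \<gamma>" "\<gamma> \<le> 1"
  shows "(\<Sum>k<N. (1 + real k) powr (\<gamma> - 1)) \<le> real N powr \<gamma> / \<gamma>"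
proof (induction N)
  case (Suc N)
  have step: "real N powr \<gamma> + \<gamma> * (1 + real N) powr (\<gamma> - 1) \<le> (1 + real N) powr \<gamma>"
  proof (cases "N = 0")
    case False
    have "real N powr \<gamma> * (1 + real N) powr (1 - \<gamma>) \<le> \<gamma> * real N + (1 - \<gamma>) * (1 + real N)"
      using False assms by (intro Youngs_inequality_0) auto
    then have "real N powr \<gamma> * (1 + real N) powr (1 - \<gamma>) + \<gamma> \<le> 1 + real N"
      by (simp add: algebra_simps)
    then have "(real N powr \<gamma> * (1 + real N) powr (1 - \<gamma>) + \<gamma>) * (1 + real N) powr (\<gamma> - 1)
        \<le> (1 + real N) * (1 + real N) powr (\<gamma> - 1)"
      by (rule mult_right_mono) simp
    moreover have "(1 + real N) * (1 + real N) powr (\<gamma> - 1) = (1 + real N) powr \<gamma>"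
      using powr_mult_base[of "1 + real N" "\<gamma> - 1"] by simp
    moreover have "(1 + real N) powr (1 - \<gamma>) * (1 + real N) powr (\<gamma> - 1) = 1"
      by (simp flip: powr_add)
    ultimately show ?thesis by (simp add: distrib_right mult.assoc)
  qed (use assms in simp)
  have "(\<Sum>k<Suc N. (1 + real k) powr (\<gamma> - 1)) \<le> real N powr \<gamma> / \<gamma> + (1 + real N) powr (\<gamma> - 1)"
    using Suc by simp
  also have "\<dots> = (real N powr \<gamma> + \<gamma> * (1 + real N) powr (\<gamma> - 1)) / \<gamma>"
    using assms by (simp add: field_simps)
  also have "\<dots> \<le> (1 + real N) powr \<gamma> / \<gamma>"
    using step assms by (intro divide_right_mono) auto
  finally show ?case by simp
qed simp

lemma sum_int_powr_le:
  fixes \<gamma> :: real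
  assumes "0 < \<gamma>" "\<gamma> \<le> 1"
  shows "(\<Sum>m\<in>{- int N..int N}. (1 + \<bar>real_of_int m\<bar>) powr (\<gamma> - 1)) \<le> 2 * (1 + real N) powr \<gamma> / \<gamma>"
proof -
  let ?w = "\<lambda>m :: int. (1 + \<bar>real_of_int m\<bar>) powr (\<gamma> - 1)"
  have "{- int N..int N} = int ` {..<Suc N} \<union> (\<lambda>k. - int k) ` {..<Suc N}"
  proof safe
    fix m assume m: "m \<in> {- int N..int N}" "m \<notin> (\<lambda>k. - int k) ` {..<Suc N}"
    have "0 \<le> m"
    proof (rule ccontr)
      assume "\<not> 0 \<le> m"
      then have "m \<in> (\<lambda>k. - int k) ` {..<Suc N}"
        using m(1) by (intro image_eqI[of _ _ "nat (- m)"]) auto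
      with m(2) show False by simp
    qed
    with m(1) show "m \<in> int ` {..<Suc N}"
      by (intro image_eqI[of _ _ "nat m"]) auto
  qed auto
  then have "sum ?w {- int N..int N} \<le> sum ?w (int ` {..<Suc N}) + sum ?w ((\<lambda>k. - int k) ` {..<Suc N})"
    using sum.union_inter[of "int ` {..<Suc N}" "(\<lambda>k. - int k) ` {..<Suc N}" ?w]
      sum_nonneg[of "int ` {..<Suc N} \<inter> (\<lambda>k. - int k) ` {..<Suc N}" ?w]
    by (simp del: sum.lessThan_Suc)
  also have "\<dots> = 2 * (\<Sum>k<Suc N. (1 + real k) powr (\<gamma> - 1))"
    by (subst (1 2) sum.reindex) (auto simp: inj_on_def)
  also have "\<dots> \<le> 2 * (real (Suc N) powr \<gamma> / \<gamma>)"
    by (intro mult_left_mono sum_powr_le assms) auto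
  finally show ?thesis by simp
qed


section \<open>The kernel of the negative fractional power\<close>

text \<open>Up to the factor \<open>1 / Gamma \<beta>\<close> this is the convolution kernel of the negative fractional power,
  the discrete counterpart of a Riesz kernel.\<close>

definition riesz_kernel :: "real \<Rightarrow> int \<Rightarrow> real" where
  "riesz_kernel \<beta> m = (LBINT \<tau>:{0<..}. heat_kernel \<tau> m / \<tau> powr (1 - \<beta>))"

lemma heat_kernel_measurable [measurable]: "(\<lambda>t. heat_kernel t m) \<in> borel_measurable borel"
proof -
  have "continuous_on UNIV (\<lambda>t. heat_kernel t m)"
    by (intro DERIV_continuous_on) (rule heat_kernel_deriv)
  then show ?thesis by (rule borel_measurable_continuous_onI)
qed

lemma heat_semigroup_measurable:
  assumes "exp_growth f"
  shows "(\<lambda>t. heat_semigroup t f n) \<in> borel_measurable borel"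
proof -
  have "continuous_on UNIV (\<lambda>t. heat_semigroup t f n)"
    by (intro DERIV_continuous_on) (rule heat_semigroup_deriv[OF assms])
  then show ?thesis by (rule borel_measurable_continuous_onI)
qed

lemma heat_kernel_bound:
  assumes "0 < t"
  shows "heat_kernel t m \<le> t powr (- (1 / 2))"
proof -
  have "heat_kernel t m \<le> heat_kernel t 0"
    using assms by (intro heat_kernel_antimono) auto
  also have "\<dots> \<le> 1 / sqrt t" using assms by (rule heat_kernel_0_bound)
  also have "\<dots> = t powr (- (1 / 2))"
    using assms by (simp add: powr_minus_divide powr_half_sqrt)
  finally show ?thesis .
qed

text \<open>The crossover lies at the diffusive time \<open>\<tau> = m\<^sup>2\<close>: before it the walk rarely reaches \<open>m\<close>
  and the bound \<open>6 \<tau> / \<bar>m\<bar>\<^sup>3\<close> is better, after it \<open>1 / sqrt \<tau>\<close> is better; both contribute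
  \<open>\<bar>m\<bar> powr (2 \<beta> - 1)\<close>. The tail is integrable because of \<open>\<beta> < 1 / 2\<close>.\<close>

lemma riesz_kernel_bound:
  assumes \<beta>: "0 < \<beta>" "\<beta> < 1 / 2"
  obtains C where "0 < C"
    "\<And>m. set_integrable lborel {0<..} (\<lambda>\<tau>. heat_kernel \<tau> m / \<tau> powr (1 - \<beta>))"
    "\<And>m. 0 \<le> riesz_kernel \<beta> m"
    "\<And>m. riesz_kernel \<beta> m \<le> C * (1 + \<bar>real_of_int m\<bar>) powr (2 * \<beta> - 1)"
proof -
  let ?h = "\<lambda>m \<tau>. heat_kernel \<tau> m / \<tau> powr (1 - \<beta>)"
  define b where "b = 1 / 2 - \<beta>"
  have b: "0 < b" using \<beta> by (simp add: b_def)
  define C where "C = 12 + 1 / \<beta> + 2 / b"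
  have meas: "?h m \<in> borel_measurable borel" for m by measurable
  have dv: "?h m \<tau> = heat_kernel \<tau> m * \<tau> powr (\<beta> - 1)" if "0 < \<tau>" for m \<tau>
    using powr_minus_divide[of \<tau> "1 - \<beta>"] by simp
  have nonneg: "0 \<le> ?h m \<tau>" if "0 < \<tau>" for m \<tau>
    using that heat_kernel_nonneg[of \<tau> m] by simp
  have far: "\<bar>?h m \<tau>\<bar> \<le> 1 * \<tau> powr (- b - 1)" if "0 < \<tau>" for m \<tau>
  proof -
    have "?h m \<tau> \<le> \<tau> powr (- (1 / 2)) * \<tau> powr (\<beta> - 1)"
      unfolding dv[OF that] by (intro mult_right_mono heat_kernel_bound that) auto
    also have "\<dots> = \<tau> powr (- b - 1)" by (simp add: b_def flip: powr_add)
    finally show ?thesis unfolding abs_of_nonneg[OF nonneg[OF that]] by simp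
  qed
  have main: "set_integrable lborel {0<..} (?h m) \<and>
      (LBINT \<tau>:{0<..}. \<bar>?h m \<tau>\<bar>) \<le> C * (1 + \<bar>real_of_int m\<bar>) powr (2 * \<beta> - 1)" for m
  proof (cases "m = 0")
    case True
    \<comment> \<open>The cubic bound is void at \<open>m = 0\<close>; the bound by \<open>1\<close> takes its place, with the crossover at \<open>\<tau> = 1\<close>.\<close>
    have near: "\<bar>?h m \<tau>\<bar> \<le> 1 * \<tau> powr (\<beta> - 1)" if "0 < \<tau>" "\<tau> \<le> 1" for \<tau>
      unfolding abs_of_nonneg[OF nonneg[OF that(1)]] unfolding dv[OF that(1)]
      by (intro mult_right_mono heat_kernel_le_1) (use that in auto)
    have "1 / b \<le> 2 / b" using b by (intro divide_right_mono) auto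
    then have le: "1 * 1 powr \<beta> / \<beta> + 1 * 1 powr (- b) / b \<le> C"
      by (simp add: C_def)
    have far': "\<bar>?h m \<tau>\<bar> \<le> 1 * \<tau> powr (- b - 1)" if "1 < \<tau>" for \<tau>
      using that by (intro far) linarith
    note * = set_integral_two_powers[OF zero_less_one \<beta>(1) b zero_le_one zero_le_one meas near far']
    show ?thesis using *(1) order_trans[OF *(2) le] True by auto
  next
    case False
    define x where "x = \<bar>real_of_int m\<bar>"
    have x: "1 \<le> x" using False by (simp add: x_def)
    define A where "A = 6 / x ^ 3"
    have near: "\<bar>?h m \<tau>\<bar> \<le> A * \<tau> powr ((\<beta> + 1) - 1)" if "0 < \<tau>" for \<tau>
    proof -
      have "?h m \<tau> \<le> (6 * \<tau> / x ^ 3) * \<tau> powr (\<beta> - 1)"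
        unfolding dv[OF that] x_def
        by (intro mult_right_mono heat_kernel_far_bound) (use that False in auto)
      also have "\<dots> = A * \<tau> powr ((\<beta> + 1) - 1)"
        using powr_mult_base[of \<tau> "\<beta> - 1"] that by (simp add: A_def)
      finally show ?thesis unfolding abs_of_nonneg[OF nonneg[OF that]] by simp
    qed
    have "A * (x powr 2) powr (\<beta> + 1) / (\<beta> + 1) + 1 * (x powr 2) powr (- b) / b
        = (6 / (\<beta> + 1) + 1 / b) * x powr (2 * \<beta> - 1)"
    proof -
      have "A = 6 * x powr (- 3)"
        using x powr_realpow[of x 3] by (simp add: A_def powr_minus_divide)
      then have "A * (x powr 2) powr (\<beta> + 1) = 6 * (x powr (- 3) * x powr (2 * (\<beta> + 1)))"
        by (simp add: powr_powr)
      also have "x powr (- 3) * x powr (2 * (\<beta> + 1)) = x powr (2 * \<beta> - 1)"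
        by (simp flip: powr_add)
      finally have "A * (x powr 2) powr (\<beta> + 1) = 6 * x powr (2 * \<beta> - 1)" .
      moreover have "(x powr 2) powr (- b) = x powr (2 * \<beta> - 1)"
        by (simp add: powr_powr b_def)
      ultimately show ?thesis by (simp add: distrib_right)
    qed
    also have "\<dots> \<le> (6 + 1 / b) * (2 * (1 + x) powr (2 * \<beta> - 1))"
    proof (rule mult_mono)
      have "6 / (\<beta> + 1) \<le> 6" using \<beta> by (simp add: divide_le_eq)
      then show "6 / (\<beta> + 1) + 1 / b \<le> 6 + 1 / b" by simp
      show "x powr (2 * \<beta> - 1) \<le> 2 * (1 + x) powr (2 * \<beta> - 1)"
        using \<beta> x by (intro powr_half_le) auto
    qed (use b in auto)
    also have "\<dots> \<le> C * (1 + x) powr (2 * \<beta> - 1)"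
    proof -
      have "(6 + 1 / b) * 2 \<le> C" using \<beta> by (simp add: C_def)
      from mult_right_mono[OF this, of "(1 + x) powr (2 * \<beta> - 1)"] show ?thesis
        by (simp only: mult.assoc powr_ge_zero)
    qed
    finally have le: "A * (x powr 2) powr (\<beta> + 1) / (\<beta> + 1) + 1 * (x powr 2) powr (- b) / b
        \<le> C * (1 + \<bar>real_of_int m\<bar>) powr (2 * \<beta> - 1)" by (simp add: x_def)
    have pos: "0 < x powr 2" "0 < \<beta> + 1" "0 \<le> A" using x \<beta> by (auto simp: A_def)
    have far': "\<bar>?h m \<tau>\<bar> \<le> 1 * \<tau> powr (- b - 1)" if "x powr 2 < \<tau>" for \<tau>
      using pos(1) that by (intro far) linarith
    note * = set_integral_two_powers[OF pos(1,2) b pos(3) zero_le_one meas near far']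
    show ?thesis using *(1) order_trans[OF *(2) le] by blast
  qed
  have absK: "(LBINT \<tau>:{0<..}. \<bar>?h m \<tau>\<bar>) = riesz_kernel \<beta> m" for m
    unfolding riesz_kernel_def
    by (intro set_lebesgue_integral_cong) (auto simp: heat_kernel_nonneg)
  show thesis
  proof (rule that)
    show "0 < C" using \<beta> b by (simp add: C_def add_pos_pos)
    show "0 \<le> riesz_kernel \<beta> m" for m
      unfolding absK[symmetric] set_lebesgue_integral_def by (rule Bochner_Integration.integral_nonneg) simp
  qed (use main absK in auto)
qed

section \<open>The fractional power under the heat flow\<close>

text \<open>A bound, up to a constant, for \<open>(- \<Delta>)\<^sup>-\<^sup>\<beta> u\<close> at \<open>n\<close>; at \<open>n = 0\<close> it is the norm of \<open>ell_neg \<beta>\<close>.\<close>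

definition riesz_majorant :: "real \<Rightarrow> (int \<Rightarrow> real) \<Rightarrow> int \<Rightarrow> real" where
  "riesz_majorant \<beta> u n = (\<Sum>\<^sub>\<infinity>j. (1 + \<bar>real_of_int (n - j)\<bar>) powr (2 * \<beta> - 1) * \<bar>u j\<bar>)"

text \<open>The crude growth bound serves only to keep everything inside the class \<open>exp_growth\<close>; the sharp
  one is lemma \<open>riesz_majorant_growth\<close>.\<close>

lemma riesz_majorant_bound:
  assumes "\<beta> \<le> 1 / 2" "u \<in> ell_neg \<beta>"
  shows "(\<lambda>j. (1 + \<bar>real_of_int (n - j)\<bar>) powr (2 * \<beta> - 1) * \<bar>u j\<bar>) summable_on UNIV"
    and "riesz_majorant \<beta> u n \<le> riesz_majorant \<beta> u 0 * (1 + \<bar>real_of_int n\<bar>) powr (1 - 2 * \<beta>)"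
proof -
  let ?w = "\<lambda>n j :: int. (1 + \<bar>real_of_int (n - j)\<bar>) powr (2 * \<beta> - 1) * \<bar>u j\<bar>"
  have "\<bar>u m\<bar> / (1 + \<bar>real_of_int m\<bar>) powr (1 - 2 * \<beta>) = ?w 0 m" for m
    using powr_minus_divide[of "1 + \<bar>real_of_int m\<bar>" "1 - 2 * \<beta>"] by simp
  then have s0: "?w 0 summable_on UNIV"
    using assms(2) by (simp add: ell_neg_def)
  have le: "?w n j \<le> ?w 0 j * (1 + \<bar>real_of_int n\<bar>) powr (1 - 2 * \<beta>)" for j
    using mult_right_mono[OF weight_shift[of "2 * \<beta>" n j], of "\<bar>u j\<bar>"] assms(1)
    by (simp add: mult_ac)
  have s1: "(\<lambda>j. ?w 0 j * (1 + \<bar>real_of_int n\<bar>) powr (1 - 2 * \<beta>)) summable_on UNIV"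
    using s0 by (rule summable_on_cmult_left)
  show s: "?w n summable_on UNIV"
    by (rule summable_on_comparison_test[OF s1 le]) auto
  have "riesz_majorant \<beta> u n \<le> (\<Sum>\<^sub>\<infinity>j. ?w 0 j * (1 + \<bar>real_of_int n\<bar>) powr (1 - 2 * \<beta>))"
    unfolding riesz_majorant_def by (rule infsum_mono[OF s s1 le])
  also have "\<dots> = riesz_majorant \<beta> u 0 * (1 + \<bar>real_of_int n\<bar>) powr (1 - 2 * \<beta>)"
    unfolding riesz_majorant_def by (rule infsum_cmult_left) (use s0 in auto)
  finally show "riesz_majorant \<beta> u n \<le> riesz_majorant \<beta> u 0 * (1 + \<bar>real_of_int n\<bar>) powr (1 - 2 * \<beta>)" .
qed

lemma exp_growth_ell_neg:
  assumes "\<beta> \<le> 1 / 2" "u \<in> ell_neg \<beta>"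
  shows "exp_growth u"
proof (rule exp_growth_polynomial)
  fix j
  have "sum (\<lambda>j. (1 + \<bar>real_of_int (0 - j)\<bar>) powr (2 * \<beta> - 1) * \<bar>u j\<bar>) {j} \<le> riesz_majorant \<beta> u 0"
    unfolding riesz_majorant_def
    by (intro finite_sum_le_infsum riesz_majorant_bound(1) assms) auto
  then have "(1 + \<bar>real_of_int j\<bar>) powr (2 * \<beta> - 1) * \<bar>u j\<bar> * (1 + \<bar>real_of_int j\<bar>) powr (1 - 2 * \<beta>)
      \<le> riesz_majorant \<beta> u 0 * (1 + \<bar>real_of_int j\<bar>) powr (1 - 2 * \<beta>)"
    by (intro mult_right_mono) auto
  moreover have "(1 + \<bar>real_of_int j\<bar>) powr (2 * \<beta> - 1) * (1 + \<bar>real_of_int j\<bar>) powr (1 - 2 * \<beta>) = 1"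
    by (simp flip: powr_add)
  ultimately show "\<bar>u j\<bar> \<le> riesz_majorant \<beta> u 0 * (1 + \<bar>real_of_int j\<bar>) powr (1 - 2 * \<beta>)"
    by (simp add: mult.assoc mult.left_commute[of _ "\<bar>u j\<bar>"])
qed (use assms in auto)

text \<open>The interchange of sum and integral is carried out twice, once for the integrand itself and once for its
  termwise absolute values, which supply the majorant.\<close>

lemma heat_flow_time_integral:
  assumes \<beta>: "0 < \<beta>" "\<beta> < 1 / 2" and f: "f \<in> ell_neg \<beta>"
  obtains C where "0 < C"
    "\<And>n. set_integrable lborel {0<..} (\<lambda>\<tau>. heat_semigroup \<tau> f n / \<tau> powr (1 - \<beta>))"
    "\<And>n. (LBINT \<tau>:{0<..}. \<bar>heat_semigroup \<tau> f n / \<tau> powr (1 - \<beta>)\<bar>) \<le> C * riesz_majorant \<beta> f n"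
proof -
  obtain C where C: "0 < C"
    "\<And>m. set_integrable lborel {0<..} (\<lambda>\<tau>. heat_kernel \<tau> m / \<tau> powr (1 - \<beta>))"
    "\<And>m. 0 \<le> riesz_kernel \<beta> m"
    "\<And>m. riesz_kernel \<beta> m \<le> C * (1 + \<bar>real_of_int m\<bar>) powr (2 * \<beta> - 1)"
    using riesz_kernel_bound[OF \<beta>] by metis
  have eg: "exp_growth f" using exp_growth_ell_neg[OF _ f] \<beta> by simp
  show thesis
  proof (rule that[OF C(1)])
    fix n
    define \<phi> where "\<phi> j \<tau> = f j * (heat_kernel \<tau> (n - j) / \<tau> powr (1 - \<beta>))" for j \<tau>
    have int: "set_integrable lborel {0<..} (\<phi> j)" for j
      unfolding \<phi>_def[abs_def] by (intro set_integrable_mult_right C(2))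
    have abs: "(LBINT \<tau>:{0<..}. \<bar>\<phi> j \<tau>\<bar>) = \<bar>f j\<bar> * riesz_kernel \<beta> (n - j)" for j
    proof -
      have "(LBINT \<tau>:{0<..}. \<bar>\<phi> j \<tau>\<bar>)
          = (LBINT \<tau>:{0<..}. \<bar>f j\<bar> * (heat_kernel \<tau> (n - j) / \<tau> powr (1 - \<beta>)))"
        by (intro set_lebesgue_integral_cong) (auto simp: \<phi>_def abs_mult heat_kernel_nonneg)
      then show ?thesis by (simp only: set_integral_mult_right riesz_kernel_def)
    qed
    have le: "\<bar>f j\<bar> * riesz_kernel \<beta> (n - j) \<le> C * ((1 + \<bar>real_of_int (n - j)\<bar>) powr (2 * \<beta> - 1) * \<bar>f j\<bar>)" for j
      using mult_left_mono[OF C(4)[of "n - j"], of "\<bar>f j\<bar>"] by (simp add: mult_ac)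
    have maj: "(\<lambda>j. C * ((1 + \<bar>real_of_int (n - j)\<bar>) powr (2 * \<beta> - 1) * \<bar>f j\<bar>)) summable_on UNIV"
      by (intro summable_on_cmult_right riesz_majorant_bound(1) f) (use \<beta> in simp)
    have sum: "(\<lambda>j. LBINT \<tau>:{0<..}. \<bar>\<phi> j \<tau>\<bar>) summable_on UNIV"
      unfolding abs by (rule summable_on_comparison_test[OF maj le]) (use C(3) in simp)
    have \<phi>: "((\<lambda>j. \<phi> j \<tau>) has_sum (heat_semigroup \<tau> f n / \<tau> powr (1 - \<beta>))) UNIV" for \<tau>
      using has_sum_cmult_left[OF heat_semigroup_has_sum[OF eg, of \<tau> n], of "1 / \<tau> powr (1 - \<beta>)"]
      by (simp add: \<phi>_def mult_ac)
    have sm: "(\<lambda>j. \<phi> j \<tau>) summable_on UNIV" for \<tau>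
      using \<phi> by (rule has_sum_imp_summable)
    have sma: "(\<lambda>j. \<bar>\<phi> j \<tau>\<bar>) summable_on UNIV" for \<tau>
      using sm[of \<tau>] summable_on_iff_abs_summable_on_real[of "\<lambda>j. \<phi> j \<tau>" UNIV] by simp
    show 1: "set_integrable lborel {0<..} (\<lambda>\<tau>. heat_semigroup \<tau> f n / \<tau> powr (1 - \<beta>))"
      using set_integral_infsum(1)[OF int sum sm] by (simp add: infsumI[OF \<phi>])
    have inta: "set_integrable lborel {0<..} (\<lambda>\<tau>. \<bar>\<phi> j \<tau>\<bar>)" for j
      using int by (rule set_integrable_abs)
    have suma: "(\<lambda>j. LBINT \<tau>:{0<..}. \<bar>\<bar>\<phi> j \<tau>\<bar>\<bar>) summable_on UNIV"
      using sum by simp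
    note A = set_integral_infsum[where \<phi> = "\<lambda>j \<tau>. \<bar>\<phi> j \<tau>\<bar>", OF inta suma sma]
    have "(LBINT \<tau>:{0<..}. \<bar>heat_semigroup \<tau> f n / \<tau> powr (1 - \<beta>)\<bar>) \<le> (LBINT \<tau>:{0<..}. \<Sum>\<^sub>\<infinity>j. \<bar>\<phi> j \<tau>\<bar>)"
    proof (rule set_integral_mono[OF set_integrable_abs[OF 1] A(1)])
      show "\<bar>heat_semigroup \<tau> f n / \<tau> powr (1 - \<beta>)\<bar> \<le> (\<Sum>\<^sub>\<infinity>j. \<bar>\<phi> j \<tau>\<bar>)" for \<tau>
        using norm_infsum_le[OF \<phi>[of \<tau>] has_sum_infsum[OF sma[of \<tau>]]] by simp
    qed
    also have "\<dots> = (\<Sum>\<^sub>\<infinity>j. \<bar>f j\<bar> * riesz_kernel \<beta> (n - j))"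
      using infsumI[OF A(2)] by (simp add: abs)
    also have "\<dots> \<le> (\<Sum>\<^sub>\<infinity>j. C * ((1 + \<bar>real_of_int (n - j)\<bar>) powr (2 * \<beta> - 1) * \<bar>f j\<bar>))"
      using sum[unfolded abs] maj le by (rule infsum_mono)
    also have "\<dots> = C * riesz_majorant \<beta> f n"
      unfolding riesz_majorant_def
      by (intro infsum_cmult_right riesz_majorant_bound(1) f) (use \<beta> in simp)
    finally show "(LBINT \<tau>:{0<..}. \<bar>heat_semigroup \<tau> f n / \<tau> powr (1 - \<beta>)\<bar>) \<le> C * riesz_majorant \<beta> f n" .
  qed
qed

lemma neg_frac_power_bound:
  assumes \<beta>: "0 < \<beta>" "\<beta> < 1 / 2" and f: "f \<in> ell_neg \<beta>"
  obtains C where "0 < C" "\<And>n. \<bar>neg_frac_power \<beta> f n\<bar> \<le> C * riesz_majorant \<beta> f n"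
proof -
  obtain C where C: "0 < C"
    "\<And>n. set_integrable lborel {0<..} (\<lambda>\<tau>. heat_semigroup \<tau> f n / \<tau> powr (1 - \<beta>))"
    "\<And>n. (LBINT \<tau>:{0<..}. \<bar>heat_semigroup \<tau> f n / \<tau> powr (1 - \<beta>)\<bar>) \<le> C * riesz_majorant \<beta> f n"
    using heat_flow_time_integral[OF assms] by metis
  have \<Gamma>: "0 < Gamma \<beta>" using \<beta> by (simp add: Gamma_real_pos)
  have "\<bar>neg_frac_power \<beta> f n\<bar> \<le> C / Gamma \<beta> * riesz_majorant \<beta> f n" for n
  proof -
    have "\<bar>LBINT \<tau>:{0<..}. heat_semigroup \<tau> f n / \<tau> powr (1 - \<beta>)\<bar> \<le> C * riesz_majorant \<beta> f n"
      using set_integral_norm_bound[OF C(2)[of n]] C(3)[of n] by simp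
    then have "1 / Gamma \<beta> * \<bar>LBINT \<tau>:{0<..}. heat_semigroup \<tau> f n / \<tau> powr (1 - \<beta>)\<bar>
        \<le> 1 / Gamma \<beta> * (C * riesz_majorant \<beta> f n)"
      using \<Gamma> by (intro mult_left_mono) auto
    then show ?thesis using \<Gamma> by (simp add: neg_frac_power_def abs_mult)
  qed
  moreover have "0 < C / Gamma \<beta>" using C(1) \<Gamma> by simp
  ultimately show thesis using that by blast
qed

lemma exp_growth_neg_frac_power:
  assumes \<beta>: "0 < \<beta>" "\<beta> < 1 / 2" and f: "f \<in> ell_neg \<beta>"
  shows "exp_growth (neg_frac_power \<beta> f)"
proof -
  obtain C where C: "0 < C" "\<And>n. \<bar>neg_frac_power \<beta> f n\<bar> \<le> C * riesz_majorant \<beta> f n"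
    using neg_frac_power_bound[OF assms] by metis
  have "\<bar>neg_frac_power \<beta> f n\<bar> \<le> (C * riesz_majorant \<beta> f 0) * (1 + \<bar>real_of_int n\<bar>) powr (1 - 2 * \<beta>)" for n
  proof -
    have "C * riesz_majorant \<beta> f n \<le> (C * riesz_majorant \<beta> f 0) * (1 + \<bar>real_of_int n\<bar>) powr (1 - 2 * \<beta>)"
      unfolding mult.assoc by (intro mult_left_mono riesz_majorant_bound(2) f) (use C \<beta> in auto)
    with C(2)[of n] show ?thesis by linarith
  qed
  then show ?thesis by (rule exp_growth_polynomial[rotated]) (use \<beta> in simp)
qed

text \<open>Applying the flow inside the time integral, by Fubini, and then the semigroup law. The absolute
  convergence comes from the fact that \<open>\<integral> \<bar>H\<^sub>\<tau> f(i)\<bar> d\<tau> / \<tau> powr (1 - \<beta>)\<close> grows at most polynomially in \<open>i\<close>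
  and is therefore summable against the heat kernel.\<close>

lemma heat_semigroup_neg_frac_power:
  assumes \<beta>: "0 < \<beta>" "\<beta> < 1 / 2" and f: "f \<in> ell_neg \<beta>" and t: "0 \<le> t"
  shows "set_integrable lborel {0<..} (\<lambda>\<tau>. heat_semigroup (t + \<tau>) f n / \<tau> powr (1 - \<beta>))"
    and "heat_semigroup t (neg_frac_power \<beta> f) n
      = 1 / Gamma \<beta> * (LBINT \<tau>:{0<..}. heat_semigroup (t + \<tau>) f n / \<tau> powr (1 - \<beta>))"
proof -
  obtain C where C: "0 < C"
    "\<And>n. set_integrable lborel {0<..} (\<lambda>\<tau>. heat_semigroup \<tau> f n / \<tau> powr (1 - \<beta>))"
    "\<And>n. (LBINT \<tau>:{0<..}. \<bar>heat_semigroup \<tau> f n / \<tau> powr (1 - \<beta>)\<bar>) \<le> C * riesz_majorant \<beta> f n"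
    using heat_flow_time_integral[OF assms(1-3)] by metis
  have eg: "exp_growth f" using exp_growth_ell_neg[OF _ f] \<beta> by simp
  define V where "V i = (LBINT \<tau>:{0<..}. \<bar>heat_semigroup \<tau> f i / \<tau> powr (1 - \<beta>)\<bar>)" for i
  have V0: "0 \<le> V i" for i
    unfolding V_def set_lebesgue_integral_def by (rule Bochner_Integration.integral_nonneg) simp
  have "\<bar>V i\<bar> \<le> (C * riesz_majorant \<beta> f 0) * (1 + \<bar>real_of_int i\<bar>) powr (1 - 2 * \<beta>)" for i
  proof -
    have "C * riesz_majorant \<beta> f i \<le> (C * riesz_majorant \<beta> f 0) * (1 + \<bar>real_of_int i\<bar>) powr (1 - 2 * \<beta>)"
      unfolding mult.assoc by (intro mult_left_mono riesz_majorant_bound(2) f) (use C \<beta> in auto)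
    with V0[of i] C(3)[of i, folded V_def] show ?thesis by linarith
  qed
  then have V: "exp_growth V" by (rule exp_growth_polynomial[rotated]) (use \<beta> in simp)
  define \<phi> where "\<phi> i \<tau> = heat_kernel t (n - i) * (heat_semigroup \<tau> f i / \<tau> powr (1 - \<beta>))" for i \<tau>
  have int: "set_integrable lborel {0<..} (\<phi> i)" for i
    unfolding \<phi>_def[abs_def] by (intro set_integrable_mult_right C(2))
  have abs: "(LBINT \<tau>:{0<..}. \<bar>\<phi> i \<tau>\<bar>) = heat_kernel t (n - i) * V i" for i
    unfolding \<phi>_def abs_mult abs_of_nonneg[OF heat_kernel_nonneg[OF t]] set_integral_mult_right V_def ..
  have sum: "(\<lambda>i. LBINT \<tau>:{0<..}. \<bar>\<phi> i \<tau>\<bar>) summable_on UNIV"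
    unfolding abs using heat_semigroup_has_sum[OF V] by (rule has_sum_imp_summable)
  have \<phi>: "((\<lambda>i. \<phi> i \<tau>) has_sum (heat_semigroup (t + \<tau>) f n / \<tau> powr (1 - \<beta>))) UNIV" for \<tau>
    using has_sum_cmult_left[OF heat_semigroup_has_sum[OF exp_growth_heat_semigroup[OF eg, of \<tau>], of t n],
        of "1 / \<tau> powr (1 - \<beta>)"]
    by (simp add: \<phi>_def mult_ac heat_semigroup_compose[OF eg])
  note A = set_integral_infsum[OF int sum has_sum_imp_summable[OF \<phi>], unfolded infsumI[OF \<phi>]]
  show "set_integrable lborel {0<..} (\<lambda>\<tau>. heat_semigroup (t + \<tau>) f n / \<tau> powr (1 - \<beta>))"
    by (rule A(1))
  have "(LBINT \<tau>:{0<..}. \<phi> i \<tau>) = heat_kernel t (n - i) * neg_frac_power \<beta> f i * Gamma \<beta>" for i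
  proof -
    have "0 < Gamma \<beta>" using \<beta> by (simp add: Gamma_real_pos)
    moreover have "(LBINT \<tau>:{0<..}. \<phi> i \<tau>)
        = heat_kernel t (n - i) * (LBINT \<tau>:{0<..}. heat_semigroup \<tau> f i / \<tau> powr (1 - \<beta>))"
      unfolding \<phi>_def by (rule set_integral_mult_right)
    ultimately show ?thesis by (simp add: neg_frac_power_def)
  qed
  with A(2) have "((\<lambda>i. heat_kernel t (n - i) * neg_frac_power \<beta> f i * Gamma \<beta>) has_sum
      (LBINT \<tau>:{0<..}. heat_semigroup (t + \<tau>) f n / \<tau> powr (1 - \<beta>))) UNIV" by simp
  moreover have "((\<lambda>i. heat_kernel t (n - i) * neg_frac_power \<beta> f i * Gamma \<beta>) has_sum
      heat_semigroup t (neg_frac_power \<beta> f) n * Gamma \<beta>) UNIV"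
    by (intro has_sum_cmult_left heat_semigroup_has_sum exp_growth_neg_frac_power assms)
  ultimately have "heat_semigroup t (neg_frac_power \<beta> f) n * Gamma \<beta>
      = (LBINT \<tau>:{0<..}. heat_semigroup (t + \<tau>) f n / \<tau> powr (1 - \<beta>))"
    by (rule has_sum_unique[symmetric])
  then show "heat_semigroup t (neg_frac_power \<beta> f) n
      = 1 / Gamma \<beta> * (LBINT \<tau>:{0<..}. heat_semigroup (t + \<tau>) f n / \<tau> powr (1 - \<beta>))"
    using Gamma_real_pos[OF \<beta>(1)] by (simp add: nonzero_eq_divide_eq)
qed

text \<open>A power of the Laplacian is a finite linear combination of shifts, so this is linearity of the integral.\<close>

lemma set_integral_laplacian_power:
  assumes "\<And>n. set_integrable M A (\<lambda>\<tau>. F \<tau> n)"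
  shows "set_integrable M A (\<lambda>\<tau>. (laplacian ^^ k) (F \<tau>) n)"
    and "(LINT \<tau>:A|M. (laplacian ^^ k) (F \<tau>) n) = (laplacian ^^ k) (\<lambda>i. LINT \<tau>:A|M. F \<tau> i) n"
proof -
  have "set_integrable M A (\<lambda>\<tau>. (laplacian ^^ k) (F \<tau>) n) \<and>
    (LINT \<tau>:A|M. (laplacian ^^ k) (F \<tau>) n) = (laplacian ^^ k) (\<lambda>i. LINT \<tau>:A|M. F \<tau> i) n" for n
  proof (induction k arbitrary: n)
    case (Suc k)
    note I = Suc.IH[THEN conjunct1]
    have "set_integrable M A (\<lambda>\<tau>. (laplacian ^^ Suc k) (F \<tau>) n)"
      unfolding funpow.simps comp_def laplacian_def[of _ n]
      by (intro set_integral_add(1) set_integral_diff(1) set_integrable_mult_right I)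
    moreover have "(LINT \<tau>:A|M. (laplacian ^^ Suc k) (F \<tau>) n)
        = laplacian (\<lambda>i. LINT \<tau>:A|M. (laplacian ^^ k) (F \<tau>) i) n"
      unfolding funpow.simps comp_def laplacian_def[of _ n]
      by (subst set_integral_add(2) set_integral_diff(2);
          (intro set_integral_diff(1) set_integrable_mult_right I)?)+ simp
    ultimately show ?case using Suc.IH[THEN conjunct2] by simp
  qed (use assms in simp)
  then show "set_integrable M A (\<lambda>\<tau>. (laplacian ^^ k) (F \<tau>) n)"
    "(LINT \<tau>:A|M. (laplacian ^^ k) (F \<tau>) n) = (laplacian ^^ k) (\<lambda>i. LINT \<tau>:A|M. F \<tau> i) n"
    by blast+
qed

lemma laplacian_power_cmult: "(laplacian ^^ k) (\<lambda>i. c * f i) n = c * (laplacian ^^ k) f n"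
  by (induction k arbitrary: n) (simp_all add: laplacian_def[of "(laplacian ^^ _) _"] algebra_simps)

lemma laplacian_heat_semigroup_neg_frac_power:
  assumes \<beta>: "0 < \<beta>" "\<beta> < 1 / 2" and f: "f \<in> ell_neg \<beta>" and t: "0 \<le> t"
  shows "heat_semigroup t ((laplacian ^^ k) (neg_frac_power \<beta> f)) n
      = 1 / Gamma \<beta> * (LBINT \<tau>:{0<..}. heat_semigroup (t + \<tau>) ((laplacian ^^ k) f) n / \<tau> powr (1 - \<beta>))"
proof -
  have eg: "exp_growth f" using exp_growth_ell_neg[OF _ f] \<beta> by simp
  let ?F = "\<lambda>\<tau> i. heat_semigroup (t + \<tau>) f i / \<tau> powr (1 - \<beta>)"
  have comm: "heat_semigroup s ((laplacian ^^ k) h) = (laplacian ^^ k) (heat_semigroup s h)"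
    if "exp_growth h" for s h
    by (rule heat_semigroup_funpow[where D = laplacian, OF exp_growth_laplacian heat_semigroup_laplacian that])
  have pot: "heat_semigroup t (neg_frac_power \<beta> f) = (\<lambda>i. 1 / Gamma \<beta> * (LBINT \<tau>:{0<..}. ?F \<tau> i))"
    by (rule ext) (rule heat_semigroup_neg_frac_power(2)[OF \<beta> f t])
  have "heat_semigroup t ((laplacian ^^ k) (neg_frac_power \<beta> f)) n
      = (laplacian ^^ k) (\<lambda>i. 1 / Gamma \<beta> * (LBINT \<tau>:{0<..}. ?F \<tau> i)) n"
    unfolding comm[OF exp_growth_neg_frac_power[OF \<beta> f]] pot ..
  also have "\<dots> = 1 / Gamma \<beta> * (LBINT \<tau>:{0<..}. (laplacian ^^ k) (?F \<tau>) n)"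
    unfolding laplacian_power_cmult
    by (simp only: set_integral_laplacian_power(2)[OF heat_semigroup_neg_frac_power(1)[OF \<beta> f t]])
  also have "\<dots> = 1 / Gamma \<beta> * (LBINT \<tau>:{0<..}. heat_semigroup (t + \<tau>) ((laplacian ^^ k) f) n / \<tau> powr (1 - \<beta>))"
  proof -
    have "(laplacian ^^ k) (?F \<tau>) n = heat_semigroup (t + \<tau>) ((laplacian ^^ k) f) n / \<tau> powr (1 - \<beta>)" for \<tau>
      using laplacian_power_cmult[of k "1 / \<tau> powr (1 - \<beta>)" "heat_semigroup (t + \<tau>) f" n]
      by (simp add: comm[OF eg])
    then show ?thesis by simp
  qed
  finally show ?thesis .
qed


section \<open>Regularity of the fractional power\<close>

text \<open>For \<open>\<bar>j\<bar> \<le> 2 \<bar>n\<bar>\<close> the sequence is at most a multiple of \<open>(1 + \<bar>n\<bar>) powr \<alpha>\<close>, and the weight sums to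
  a multiple of \<open>(1 + \<bar>n\<bar>) powr (2 \<beta>)\<close>. For \<open>\<bar>j\<bar> > 2 \<bar>n\<bar>\<close> the distance \<open>\<bar>n - j\<bar>\<close> is comparable to \<open>\<bar>j\<bar>\<close>, and the sum is
  bounded by its value at \<open>n = 0\<close>.\<close>

lemma riesz_majorant_growth:
  assumes \<beta>: "0 < \<beta>" "\<beta> < 1 / 2" and \<alpha>: "0 \<le> \<alpha>" and u: "u \<in> ell_neg \<beta>"
    and C: "\<And>j. \<bar>u j\<bar> \<le> C * (1 + \<bar>real_of_int j\<bar>) powr \<alpha>"
  obtains D where "0 \<le> D" "\<And>n. riesz_majorant \<beta> u n \<le> D * (1 + \<bar>real_of_int n\<bar>) powr (\<alpha> + 2 * \<beta>)"
proof -
  let ?w = "\<lambda>m :: int. (1 + \<bar>real_of_int m\<bar>) powr (2 * \<beta> - 1)"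
  define S where "S = riesz_majorant \<beta> u 0"
  have S: "0 \<le> S" unfolding S_def riesz_majorant_def by (intro infsum_nonneg) auto
  have C0: "0 \<le> C" using C[of 0] by simp
  have "riesz_majorant \<beta> u n \<le> (C * 2 powr \<alpha> * (3 / \<beta>) + 2 * S) * (1 + \<bar>real_of_int n\<bar>) powr (\<alpha> + 2 * \<beta>)" for n
  proof -
    define N where "N = nat (3 * \<bar>n\<bar>)"
    define M where "M = 1 + \<bar>real_of_int n\<bar>"
    define A where "A = C * (2 * M) powr \<alpha>"
    have A: "0 \<le> A" using C0 by (simp add: A_def)
    have le: "?w (n - j) * \<bar>u j\<bar> \<le> A * (?w (n - j) * of_bool (\<bar>n - j\<bar> \<le> int N)) + 2 * (?w (0 - j) * \<bar>u j\<bar>)" for j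
    proof (cases "\<bar>j\<bar> \<le> 2 * \<bar>n\<bar>")
      case True
      have "real_of_int \<bar>j\<bar> \<le> real_of_int (2 * \<bar>n\<bar>)" using True by (simp only: of_int_le_iff)
      then have "(1 + \<bar>real_of_int j\<bar>) powr \<alpha> \<le> (2 * M) powr \<alpha>"
        using \<alpha> by (intro powr_mono2) (auto simp: M_def)
      then have "C * (1 + \<bar>real_of_int j\<bar>) powr \<alpha> \<le> A"
        unfolding A_def by (rule mult_left_mono[OF _ C0])
      then have "\<bar>u j\<bar> \<le> A" using C[of j] by linarith
      then have "?w (n - j) * \<bar>u j\<bar> \<le> A * ?w (n - j)"
        using mult_left_mono[of "\<bar>u j\<bar>" A "?w (n - j)"] by (simp add: mult.commute)
      moreover have "of_bool (\<bar>n - j\<bar> \<le> int N) = (1 :: real)" using True by (simp add: N_def)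
      moreover have "0 \<le> 2 * (?w (0 - j) * \<bar>u j\<bar>)" by simp
      ultimately show ?thesis by (simp only: mult_1_right)
    next
      case False
      have "?w (n - j) \<le> 2 * ?w (0 - j)"
      proof (rule powr_half_le)
        have "\<bar>j\<bar> + 1 \<le> 2 * (1 + \<bar>n - j\<bar>)" using False by arith
        then have "real_of_int (\<bar>j\<bar> + 1) \<le> real_of_int (2 * (1 + \<bar>n - j\<bar>))"
          by (simp only: of_int_le_iff)
        then show "(1 + \<bar>real_of_int (0 - j)\<bar>) / 2 \<le> 1 + \<bar>real_of_int (n - j)\<bar>" by simp
      qed (use \<beta> in auto)
      from mult_right_mono[OF this, of "\<bar>u j\<bar>"]
      have "?w (n - j) * \<bar>u j\<bar> \<le> 2 * (?w (0 - j) * \<bar>u j\<bar>)" by simp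
      moreover have "0 \<le> A * (?w (n - j) * of_bool (\<bar>n - j\<bar> \<le> int N))" using A by simp
      ultimately show ?thesis by linarith
    qed
    have s1: "((\<lambda>j. ?w (n - j) * of_bool (\<bar>n - j\<bar> \<le> int N)) has_sum (\<Sum>m\<in>{- int N..int N}. ?w m)) UNIV"
    proof -
      have "((\<lambda>m. ?w m * of_bool (\<bar>m\<bar> \<le> int N)) has_sum (\<Sum>m\<in>{- int N..int N}. ?w m)) UNIV"
        by (rule has_sum_finite_neutralI[of "{- int N..int N}"]) (auto intro!: sum.cong)
      then show ?thesis
        by (subst has_sum_reindex_bij_witness[where i = "\<lambda>m. n - m" and j = "\<lambda>j. n - j" and T = UNIV
              and h = "\<lambda>m. ?w m * of_bool (\<bar>m\<bar> \<le> int N)"]) auto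
    qed
    have s2: "((\<lambda>j. ?w (0 - j) * \<bar>u j\<bar>) has_sum S) UNIV"
      unfolding S_def riesz_majorant_def
      by (intro has_sum_infsum riesz_majorant_bound(1) u) (use \<beta> in simp)
    have s3: "((\<lambda>j. ?w (n - j) * \<bar>u j\<bar>) has_sum riesz_majorant \<beta> u n) UNIV"
      unfolding riesz_majorant_def
      by (intro has_sum_infsum riesz_majorant_bound(1) u) (use \<beta> in simp)
    have "riesz_majorant \<beta> u n \<le> A * (\<Sum>m\<in>{- int N..int N}. ?w m) + 2 * S"
      by (rule has_sum_mono[OF s3 has_sum_add[OF has_sum_cmult_right[OF s1] has_sum_cmult_right[OF s2]] le])
    also have "\<dots> \<le> A * (3 / \<beta> * M powr (2 * \<beta>)) + 2 * S * M powr (\<alpha> + 2 * \<beta>)"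
    proof (rule add_mono)
      have "(\<Sum>m\<in>{- int N..int N}. ?w m) \<le> 2 * (1 + real N) powr (2 * \<beta>) / (2 * \<beta>)"
        using \<beta> by (intro sum_int_powr_le) auto
      also have "\<dots> \<le> 2 * (3 * M powr (2 * \<beta>)) / (2 * \<beta>)"
      proof -
        have "(1 + real N) powr (2 * \<beta>) \<le> (3 * M) powr (2 * \<beta>)"
          using \<beta> by (intro powr_mono2) (auto simp: N_def M_def)
        also have "\<dots> = 3 powr (2 * \<beta>) * M powr (2 * \<beta>)" by (rule powr_mult)
        also have "\<dots> \<le> 3 powr 1 * M powr (2 * \<beta>)"
          using \<beta> by (intro mult_right_mono powr_mono) auto
        finally show ?thesis using \<beta> by (intro divide_right_mono mult_left_mono) auto
      qed
      also have "\<dots> = 3 / \<beta> * M powr (2 * \<beta>)" using \<beta> by (simp add: field_simps)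
      finally show "A * (\<Sum>m\<in>{- int N..int N}. ?w m) \<le> A * (3 / \<beta> * M powr (2 * \<beta>))"
        by (rule mult_left_mono[OF _ A])
      have "1 \<le> M powr (\<alpha> + 2 * \<beta>)"
        using \<alpha> \<beta> by (intro ge_one_powr_ge_zero) (auto simp: M_def)
      then show "2 * S \<le> 2 * S * M powr (\<alpha> + 2 * \<beta>)"
        using S mult_left_mono[of 1 "M powr (\<alpha> + 2 * \<beta>)" "2 * S"] by simp
    qed
    also have "A * (3 / \<beta> * M powr (2 * \<beta>)) = C * 2 powr \<alpha> * (3 / \<beta>) * M powr (\<alpha> + 2 * \<beta>)"
      by (simp add: A_def powr_mult powr_add)
    finally show ?thesis by (simp add: M_def distrib_right)
  qed
  moreover have "0 \<le> C * 2 powr \<alpha> * (3 / \<beta>) + 2 * S" using C0 S \<beta> by simp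
  ultimately show thesis using that by blast
qed

text \<open>The weights \<open>1 + \<bar>n\<bar> powr \<alpha>\<close> and \<open>(1 + \<bar>n\<bar>) powr \<alpha>\<close> are comparable; the second one
  turns addition of growth exponents into multiplication of weights.\<close>

lemma bounded_quotient_iff_growth:
  assumes "0 < \<alpha>"
  shows "bounded (range (\<lambda>n. f n / (1 + real_of_int \<bar>n\<bar> powr \<alpha>)))
    \<longleftrightarrow> (\<exists>C. \<forall>n. \<bar>f n\<bar> \<le> C * (1 + \<bar>real_of_int n\<bar>) powr \<alpha>)"
proof
  assume "bounded (range (\<lambda>n. f n / (1 + real_of_int \<bar>n\<bar> powr \<alpha>)))"
  then obtain B where B: "\<bar>f n / (1 + real_of_int \<bar>n\<bar> powr \<alpha>)\<bar> \<le> B" for n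
    unfolding bounded_iff by auto
  have "\<bar>f n\<bar> \<le> (2 * B) * (1 + \<bar>real_of_int n\<bar>) powr \<alpha>" for n
  proof -
    define x where "x = \<bar>real_of_int n\<bar>"
    have x: "0 \<le> x" by (simp add: x_def)
    have B0: "0 \<le> B" using B[of 0] by linarith
    have pos: "0 < 1 + x powr \<alpha>" by (simp add: add_pos_nonneg)
    have "\<bar>f n\<bar> \<le> B * (1 + x powr \<alpha>)"
      using B[of n] pos by (simp add: x_def abs_divide divide_le_eq)
    also have "\<dots> \<le> B * (2 * (1 + x) powr \<alpha>)"
    proof (rule mult_left_mono[OF _ B0])
      have "1 \<le> (1 + x) powr \<alpha>" using x assms by (intro ge_one_powr_ge_zero) auto
      moreover have "x powr \<alpha> \<le> (1 + x) powr \<alpha>" using x assms by (intro powr_mono2) auto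
      ultimately show "1 + x powr \<alpha> \<le> 2 * (1 + x) powr \<alpha>" by simp
    qed
    finally show ?thesis by (simp add: x_def mult_ac)
  qed
  then show "\<exists>C. \<forall>n. \<bar>f n\<bar> \<le> C * (1 + \<bar>real_of_int n\<bar>) powr \<alpha>" by blast
next
  assume "\<exists>C. \<forall>n. \<bar>f n\<bar> \<le> C * (1 + \<bar>real_of_int n\<bar>) powr \<alpha>"
  then obtain C where C: "\<And>n. \<bar>f n\<bar> \<le> C * (1 + \<bar>real_of_int n\<bar>) powr \<alpha>" by blast
  have C0: "0 \<le> C" using C[of 0] by simp
  have "\<bar>f n / (1 + real_of_int \<bar>n\<bar> powr \<alpha>)\<bar> \<le> C * 2 powr \<alpha>" for n
  proof -
    define x where "x = \<bar>real_of_int n\<bar>"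
    have x: "0 \<le> x" by (simp add: x_def)
    have pos: "0 < 1 + x powr \<alpha>" by (simp add: add_pos_nonneg)
    have "(1 + x) powr \<alpha> \<le> (2 * max 1 x) powr \<alpha>"
      using x assms by (intro powr_mono2) auto
    also have "\<dots> = 2 powr \<alpha> * max 1 x powr \<alpha>" by (rule powr_mult)
    also have "\<dots> \<le> 2 powr \<alpha> * (1 + x powr \<alpha>)"
      by (intro mult_left_mono) (auto simp: max_def)
    finally have "C * (1 + x) powr \<alpha> \<le> C * (2 powr \<alpha> * (1 + x powr \<alpha>))"
      by (rule mult_left_mono[OF _ C0])
    then have "\<bar>f n\<bar> \<le> C * 2 powr \<alpha> * (1 + x powr \<alpha>)"
      using C[of n] by (simp add: x_def mult.assoc)
    then show ?thesis using pos by (simp add: x_def abs_divide divide_le_eq)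
  qed
  then show "bounded (range (\<lambda>n. f n / (1 + real_of_int \<bar>n\<bar> powr \<alpha>)))"
    unfolding bounded_iff by auto
qed

lemma Lambda_H_iff:
  assumes "0 < \<alpha>"
  shows "f \<in> Lambda_H \<alpha> \<longleftrightarrow>
    (\<exists>C. \<forall>n. \<bar>f n\<bar> \<le> C * (1 + \<bar>real_of_int n\<bar>) powr \<alpha>) \<and>
    (\<exists>C. \<forall>t>0. \<forall>n. \<bar>heat_semigroup t ((laplacian ^^ (nat \<lfloor>\<alpha> / 2\<rfloor> + 1)) f) n\<bar>
        \<le> C * t powr (- real (nat \<lfloor>\<alpha> / 2\<rfloor> + 1) + \<alpha> / 2))"
proof -
  define k where "k = nat \<lfloor>\<alpha> / 2\<rfloor> + 1"
  have pos: "(\<exists>C>0. \<forall>t>0. \<forall>n. Q t n \<le> C * t powr e) \<longleftrightarrow> (\<exists>C. \<forall>t>0. \<forall>n. Q t n \<le> C * t powr e)"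
    for Q :: "real \<Rightarrow> int \<Rightarrow> real" and e
  proof
    assume "\<exists>C. \<forall>t>0. \<forall>n. Q t n \<le> C * t powr e"
    then obtain C where C: "\<And>t n. 0 < t \<Longrightarrow> Q t n \<le> C * t powr e" by blast
    have "Q t n \<le> (\<bar>C\<bar> + 1) * t powr e" if "0 < t" for t n
      by (rule order_trans[OF C[OF that]], rule mult_right_mono) auto
    then show "\<exists>C>0. \<forall>t>0. \<forall>n. Q t n \<le> C * t powr e"
      by (intro exI[of _ "\<bar>C\<bar> + 1"]) auto
  qed blast
  have "\<bar>(deriv ^^ k) (\<lambda>s. heat_semigroup s f n) t\<bar> = \<bar>heat_semigroup t ((laplacian ^^ k) f) n\<bar>"
    if "\<exists>C. \<forall>n. \<bar>f n\<bar> \<le> C * (1 + \<bar>real_of_int n\<bar>) powr \<alpha>" for n t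
    using that assms heat_semigroup_higher_deriv[OF exp_growth_polynomial[of \<alpha> f]] by fastforce
  then show ?thesis
    unfolding Lambda_H_def mem_Collect_eq Let_def bounded_quotient_iff_growth[OF assms]
      k_def[symmetric] pos by (simp cong: conj_cong)
qed

text \<open>The common core of both parts: \<open>\<alpha> = 0\<close> is admitted and stands for bounded sequences. The order
  \<open>k\<close> is the one that belongs to the target exponent \<open>\<alpha> + 2 \<beta>\<close>; it makes \<open>b\<close> below positive, and
  this is the convergence of the integral of \<open>(t + \<tau>) powr (- k + \<alpha> / 2) / \<tau> powr (1 - \<beta>)\<close> at infinity.\<close>

lemma neg_frac_power_in_Lambda_H:
  assumes \<beta>: "0 < \<beta>" "\<beta> < 1 / 2" and \<alpha>: "0 \<le> \<alpha>" and f: "f \<in> ell_neg \<beta>"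
    and growth: "\<And>j. \<bar>f j\<bar> \<le> C * (1 + \<bar>real_of_int j\<bar>) powr \<alpha>"
    and k: "k = nat \<lfloor>(\<alpha> + 2 * \<beta>) / 2\<rfloor> + 1"
    and decay: "\<And>t n. 0 < t \<Longrightarrow>
      \<bar>heat_semigroup t ((laplacian ^^ k) f) n\<bar> \<le> B * t powr (- real k + \<alpha> / 2)"
  shows "neg_frac_power \<beta> f \<in> Lambda_H (\<alpha> + 2 * \<beta>)"
proof -
  let ?g = "neg_frac_power \<beta> f"
  have eg: "exp_growth f" using exp_growth_ell_neg[OF _ f] \<beta> by simp
  have 1: "\<exists>C. \<forall>n. \<bar>?g n\<bar> \<le> C * (1 + \<bar>real_of_int n\<bar>) powr (\<alpha> + 2 * \<beta>)"
  proof -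
    obtain E where E: "0 < E" "\<And>n. \<bar>?g n\<bar> \<le> E * riesz_majorant \<beta> f n"
      using neg_frac_power_bound[OF \<beta> f] by metis
    obtain D where D: "0 \<le> D" "\<And>n. riesz_majorant \<beta> f n \<le> D * (1 + \<bar>real_of_int n\<bar>) powr (\<alpha> + 2 * \<beta>)"
      using riesz_majorant_growth[OF \<beta> \<alpha> f growth] by metis
    have "\<bar>?g n\<bar> \<le> (E * D) * (1 + \<bar>real_of_int n\<bar>) powr (\<alpha> + 2 * \<beta>)" for n
      using order_trans[OF E(2)[of n] mult_left_mono[OF D(2)[of n] less_imp_le[OF E(1)]]]
      by (simp only: mult.assoc)
    then show ?thesis by blast
  qed
  define b where "b = real k - \<alpha> / 2 - \<beta>"
  have b: "0 < b"
  proof -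
    have "(\<alpha> + 2 * \<beta>) / 2 < real k"
    proof -
      have "0 \<le> \<lfloor>(\<alpha> + 2 * \<beta>) / 2\<rfloor>" using \<alpha> \<beta> by simp
      then have "real k = real_of_int \<lfloor>(\<alpha> + 2 * \<beta>) / 2\<rfloor> + 1" unfolding k by simp
      then show ?thesis using floor_correct[of "(\<alpha> + 2 * \<beta>) / 2"] by linarith
    qed
    then show ?thesis by (simp add: b_def)
  qed
  have B: "0 \<le> B" using decay[of 1 0] by simp
  have \<Gamma>: "0 < Gamma \<beta>" using \<beta> by (simp add: Gamma_real_pos)
  have "\<bar>heat_semigroup t ((laplacian ^^ k) ?g) n\<bar>
      \<le> (1 / Gamma \<beta> * (B * (1 / \<beta> + 1 / b))) * t powr (- real k + (\<alpha> + 2 * \<beta>) / 2)" if t: "0 < t" for t n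
  proof -
    let ?h = "\<lambda>\<tau>. heat_semigroup (t + \<tau>) ((laplacian ^^ k) f) n / \<tau> powr (1 - \<beta>)"
    define e where "e = - real k + \<alpha> / 2"
    have e: "e = - b - \<beta>" "e \<le> 0" using b \<beta> by (auto simp: e_def b_def)
    have "(\<lambda>s. heat_semigroup s ((laplacian ^^ k) f) n) \<in> borel_measurable borel"
      by (rule heat_semigroup_measurable[OF exp_growth_funpow[OF exp_growth_laplacian eg]])
    from measurable_compose[OF _ this, of "\<lambda>\<tau>. t + \<tau>" borel]
    have meas: "?h \<in> borel_measurable borel" by measurable
    have bound: "\<bar>?h \<tau>\<bar> \<le> B * x powr e * \<tau> powr (\<beta> - 1)" if "0 < \<tau>" "0 < x" "x \<le> t + \<tau>" for \<tau> x
    proof -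
      have "\<bar>heat_semigroup (t + \<tau>) ((laplacian ^^ k) f) n\<bar> \<le> B * (t + \<tau>) powr e"
        unfolding e_def using that t by (intro decay) simp
      also have "\<dots> \<le> B * x powr e"
        using that e(2) by (intro mult_left_mono powr_mono2' B) auto
      finally have "\<bar>heat_semigroup (t + \<tau>) ((laplacian ^^ k) f) n\<bar> * \<tau> powr (\<beta> - 1)
          \<le> B * x powr e * \<tau> powr (\<beta> - 1)"
        by (rule mult_right_mono) simp
      moreover have "\<tau> powr (\<beta> - 1) = 1 / \<tau> powr (1 - \<beta>)"
        using powr_minus_divide[of \<tau> "1 - \<beta>"] by simp
      ultimately show ?thesis by (simp add: abs_divide)
    qed
    \<comment> \<open>\<open>t + \<tau>\<close> is replaced by the larger of \<open>t\<close> and \<open>\<tau>\<close>, which it exceeds by a factor of at most \<open>2\<close>.\<close>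
    have near: "\<bar>?h \<tau>\<bar> \<le> (B * t powr e) * \<tau> powr (\<beta> - 1)" if "0 < \<tau>" "\<tau> \<le> t" for \<tau>
      using bound[of \<tau> t] that t by simp
    have far: "\<bar>?h \<tau>\<bar> \<le> B * \<tau> powr (- b - 1)" if "t < \<tau>" for \<tau>
    proof -
      have "\<bar>?h \<tau>\<bar> \<le> B * \<tau> powr e * \<tau> powr (\<beta> - 1)"
        using that t by (intro bound) auto
      also have "\<dots> = B * \<tau> powr (- b - 1)" by (simp add: e(1) mult.assoc flip: powr_add)
      finally show ?thesis .
    qed
    have A0: "0 \<le> B * t powr e" using B by simp
    note I = set_integral_two_powers[OF t \<beta>(1) b A0 B meas near far]
    have "\<bar>LBINT \<tau>:{0<..}. ?h \<tau>\<bar> \<le> (LBINT \<tau>:{0<..}. \<bar>?h \<tau>\<bar>)"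
      using set_integral_norm_bound[OF I(1)] by simp
    also have "\<dots> \<le> B * t powr e * t powr \<beta> / \<beta> + B * t powr (- b) / b" by (rule I(2))
    also have "\<dots> = B * (1 / \<beta> + 1 / b) * t powr (- b)"
      by (simp add: e(1) mult.assoc distrib_left distrib_right flip: powr_add)
    finally have "1 / Gamma \<beta> * \<bar>LBINT \<tau>:{0<..}. ?h \<tau>\<bar> \<le> 1 / Gamma \<beta> * (B * (1 / \<beta> + 1 / b) * t powr (- b))"
      using \<Gamma> by (intro mult_left_mono) auto
    moreover have "- b = - real k + (\<alpha> + 2 * \<beta>) / 2" by (simp add: b_def add_divide_distrib)
    ultimately show ?thesis
      unfolding laplacian_heat_semigroup_neg_frac_power[OF \<beta> f less_imp_le[OF t]] abs_mult
      using \<Gamma> by (simp add: mult.assoc)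
  qed
  moreover have "0 < \<alpha> + 2 * \<beta>" using \<alpha> \<beta> by simp
  ultimately show ?thesis
    unfolding Lambda_H_iff[OF \<open>0 < \<alpha> + 2 * \<beta>\<close>] k[symmetric] using 1 by blast
qed

text \<open>The decay estimate passes to the next order: the first half of the time is spent on the given estimate and
  the second half on smoothing the additional Laplacian.\<close>

lemma heat_semigroup_laplacian_power_Suc:
  assumes f: "exp_growth f"
    and decay: "\<And>t n. 0 < t \<Longrightarrow> \<bar>heat_semigroup t ((laplacian ^^ k) f) n\<bar> \<le> C * t powr e"
    and t: "0 < t"
  shows "\<bar>heat_semigroup t ((laplacian ^^ Suc k) f) n\<bar> \<le> (8 * C / 2 powr (e - 1)) * t powr (e - 1)"
proof -
  let ?v = "(laplacian ^^ k) f"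
  have v: "exp_growth ?v" by (rule exp_growth_funpow[OF exp_growth_laplacian f])
  have "heat_semigroup t ((laplacian ^^ Suc k) f) n
      = heat_semigroup (t / 2) (heat_semigroup (t / 2) (laplacian ?v)) n"
    using heat_semigroup_compose[OF exp_growth_laplacian[OF v], of "t / 2" "t / 2" n] by simp
  also have "\<dots> = heat_semigroup (t / 2) (laplacian (heat_semigroup (t / 2) ?v)) n"
    by (simp add: heat_semigroup_laplacian[OF v])
  also have "\<bar>\<dots>\<bar> \<le> 8 * (C * (t / 2) powr e) / (t / 2)"
    by (intro heat_semigroup_laplacian_bound decay) (use t in auto)
  also have "\<dots> = 8 * C * (t / 2) powr (e - 1)"
    using t by (simp add: powr_diff)
  also have "\<dots> = (8 * C / 2 powr (e - 1)) * t powr (e - 1)"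
    using t by (simp add: powr_divide)
  finally show ?thesis .
qed

theorem theorem3:
  fixes \<alpha> \<beta> :: real and f :: "int \<Rightarrow> real"
  assumes "\<alpha> > 0" and "0 < \<beta>" and "\<beta> < 1 / 2"
  shows "(f \<in> Lambda_H \<alpha> \<inter> ell_neg \<beta> \<longrightarrow> neg_frac_power \<beta> f \<in> Lambda_H (\<alpha> + 2 * \<beta>)) \<and>
    (f \<in> ell_infty \<inter> ell_neg \<beta> \<longrightarrow> neg_frac_power \<beta> f \<in> Lambda_H (2 * \<beta>))"
proof (intro conjI impI)
  assume "f \<in> Lambda_H \<alpha> \<inter> ell_neg \<beta>"
  then have fL: "f \<in> Lambda_H \<alpha>" and f: "f \<in> ell_neg \<beta>" by auto
  have eg: "exp_growth f" using exp_growth_ell_neg[OF _ f] assms by simp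
  define k where "k = nat \<lfloor>\<alpha> / 2\<rfloor> + 1"
  define l where "l = nat \<lfloor>(\<alpha> + 2 * \<beta>) / 2\<rfloor> + 1"
  from fL obtain A where A: "\<And>n. \<bar>f n\<bar> \<le> A * (1 + \<bar>real_of_int n\<bar>) powr \<alpha>"
    unfolding Lambda_H_iff[OF assms(1)] by blast
  from fL obtain C where C: "\<And>t n. 0 < t \<Longrightarrow>
      \<bar>heat_semigroup t ((laplacian ^^ k) f) n\<bar> \<le> C * t powr (- real k + \<alpha> / 2)"
    unfolding Lambda_H_iff[OF assms(1)] k_def[symmetric] by blast
  have "l = k \<or> l = Suc k"
  proof -
    have "\<lfloor>\<alpha> / 2\<rfloor> \<le> \<lfloor>(\<alpha> + 2 * \<beta>) / 2\<rfloor>"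
      using assms by (intro floor_mono) simp
    moreover have "(\<alpha> + 2 * \<beta>) / 2 \<le> \<alpha> / 2 + 1" using assms by (simp add: add_divide_distrib)
    then have "\<lfloor>(\<alpha> + 2 * \<beta>) / 2\<rfloor> \<le> \<lfloor>\<alpha> / 2 + 1\<rfloor>" by (rule floor_mono)
    moreover have "0 \<le> \<lfloor>\<alpha> / 2\<rfloor>" using assms by simp
    ultimately show ?thesis unfolding k_def l_def by auto
  qed
  then have "\<exists>B. \<forall>t>0. \<forall>n. \<bar>heat_semigroup t ((laplacian ^^ l) f) n\<bar> \<le> B * t powr (- real l + \<alpha> / 2)"
  proof
    assume "l = Suc k"
    moreover from this have "- real k + \<alpha> / 2 - 1 = - real l + \<alpha> / 2" by simp
    ultimately show ?thesis
      using heat_semigroup_laplacian_power_Suc[OF eg C] by metis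
  qed (use C in blast)
  then obtain B where "\<And>t n. 0 < t \<Longrightarrow>
      \<bar>heat_semigroup t ((laplacian ^^ l) f) n\<bar> \<le> B * t powr (- real l + \<alpha> / 2)" by blast
  from neg_frac_power_in_Lambda_H[OF assms(2,3) less_imp_le[OF assms(1)] f A l_def this]
  show "neg_frac_power \<beta> f \<in> Lambda_H (\<alpha> + 2 * \<beta>)" .
next
  assume "f \<in> ell_infty \<inter> ell_neg \<beta>"
  then have f: "f \<in> ell_neg \<beta>" and "bounded (range f)" by (auto simp: ell_infty_def)
  then obtain A where A: "\<And>n. \<bar>f n\<bar> \<le> A" unfolding bounded_iff by auto
  have one: "nat \<lfloor>(0 + 2 * \<beta>) / 2\<rfloor> + 1 = (1 :: nat)"
    using assms by (simp add: floor_eq_iff)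
  have "\<bar>heat_semigroup t ((laplacian ^^ 1) f) n\<bar> \<le> (8 * A) * t powr (- real 1 + 0 / 2)" if "0 < t" for t n
    using heat_semigroup_laplacian_bound[OF that A, where n = n] that by (simp add: powr_minus_divide)
  moreover have "\<bar>f j\<bar> \<le> A * (1 + \<bar>real_of_int j\<bar>) powr 0" for j
  proof -
    have "1 + \<bar>real_of_int j\<bar> \<noteq> 0" by linarith
    then show ?thesis using A[of j] by simp
  qed
  ultimately have "neg_frac_power \<beta> f \<in> Lambda_H (0 + 2 * \<beta>)"
    using neg_frac_power_in_Lambda_H[OF assms(2,3) order_refl f _ one[symmetric]] by blast
  then show "neg_frac_power \<beta> f \<in> Lambda_H (2 * \<beta>)" by simp
qed

end
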